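(* Assume the setting and Assumption A in the context, and let $m_j$ be the means output by the Gaussian projected filter (Algorithm GPF) with inflation $Q=aP$. Then, if the inflation parameter $a>0$ is sufficiently large, there is a constant $\mathsf C_1$ independent of $\varepsilon$ such that $$\limsup_{j\to\infty}\mathbb E\|m_j-u_j\|\le\mathsf C_1\varepsilon.$$
   Context: $\mathcal H$ separable Hilbert space, $\Psi:\mathcal H\to\mathcal H$, $u_0\in\mathcal H$, signal $u_j=\Psi(u_{j-1})$. $H:\mathcal H\to\mathbb R^k$ linear with $HH^*=I_k$, $P:=H^*H$; observations $y_j=Hu_j+\varepsilon\eta_j$, $\varepsilon>0$, $\eta_j$ independent with mean zero and covariance $R$. $V(u):=(\|u\|^2+\beta\|Pu\|^2)^{1/2}$. Assumption A: there exist $r>0,\beta\ge0,L>0,\alpha\in(0,1)$ such that $\mathcal B=\{\|u\|\le r\}$ is absorbing and forward invariant for $\Psi$, $V^2(\Psi(u)-\Psi(v))\le LV^2(u-v)$ and $V^2((I-P)(\Psi(u)-\Psi(v)))\le\alpha V^2(u-v)$ for all $u,v\in\mathcal B$. $P_{\mathcal B_V}$: orthogonal projection onto $\mathcal B$ in the $V$-norm. $\mathscr K(\Sigma):=\Sigma H^*(H\Sigma H^*+\varepsilon^2R)^{-1}$. Algorithm GPF: given $m_0\in\mathcal H$ and covariance operator $C_0$; for $j\ge1$, $\mu_j=\mathbb E_{u\sim\mathcal N(m_{j-1},C_{j-1})}[\Psi(P_{\mathcal B_V}u)]$, $\Sigma_j=\mathbb E_{u\sim\mathcal N(m_{j-1},C_{j-1})}[(\Psi(P_{\mathcal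 B_V}u)-\mu_j)\otimes(\Psi(P_{\mathcal B_V}u)-\mu_j)]$, $m_j=\mu_j+\mathscr K(\Sigma_j+Q)(y_j-H\mu_j)$, $C_j=(I-\mathscr K(\Sigma_j+Q)H)(\Sigma_j+Q)$. The expectation is over the observation noise. *)

theory Defs
  imports "HOL-Analysis.Analysis" "HOL-Probability.Probability"
begin

type_synonym 'h op = "'h \<Rightarrow> 'h"

definition gaussian_measure :: "'h::{real_inner,polish_space} \<Rightarrow> 'h op \<Rightarrow> 'h measure \<Rightarrow> bool" where
  "gaussian_measure m C \<mu> \<longleftrightarrow>
     linear C \<and> (\<forall>x y. C x \<bullet> y = x \<bullet> C y) \<and> (\<forall>h. 0 \<le> C h \<bullet> h) \<and>
     sets \<mu> = sets borel \<and> prob_space \<mu> \<and>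
     (\<forall>h. distr \<mu> borel (\<lambda>u. u \<bullet> h) =
            (if C h \<bullet> h = 0 then return borel (m \<bullet> h)
             else density lborel (normal_density (m \<bullet> h) (sqrt (C h \<bullet> h)))))"

definition gauss :: "'h::{real_inner,polish_space} \<Rightarrow> 'h op \<Rightarrow> 'h measure" where
  "gauss m C = (THE \<mu>. gaussian_measure m C \<mu>)"

text \<open>Orthogonal projection P = H* H and the norm V.\<close>
definition Pop :: "('h::real_inner \<Rightarrow> real^'k) \<Rightarrow> (real^'k \<Rightarrow> 'h) \<Rightarrow> 'h op" where
  "Pop H Hs = (\<lambda>u. Hs (H u))"

definition Vnorm :: "real \<Rightarrow> ('h::real_inner \<Rightarrow> real^'k) \<Rightarrow> (real^'k \<Rightarrow> 'h) \<Rightarrow> 'h \<Rightarrow> real" where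
  "Vnorm \<beta> H Hs u = sqrt ((norm u)\<^sup>2 + \<beta> * (norm (Pop H Hs u))\<^sup>2)"

definition projBV :: "real \<Rightarrow> real \<Rightarrow> ('h::real_inner \<Rightarrow> real^'k) \<Rightarrow> (real^'k \<Rightarrow> 'h) \<Rightarrow> 'h op" where
  "projBV r \<beta> H Hs u = (THE v. v \<in> cball 0 r \<and>
      (\<forall>w\<in>cball 0 r. Vnorm \<beta> H Hs (u - v) \<le> Vnorm \<beta> H Hs (u - w)))"

definition assumptionA :: "real \<Rightarrow> real \<Rightarrow> real \<Rightarrow> real \<Rightarrow> ('h::real_inner \<Rightarrow> 'h)
     \<Rightarrow> ('h \<Rightarrow> real^'k) \<Rightarrow> (real^'k \<Rightarrow> 'h) \<Rightarrow> bool" where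
  "assumptionA r \<beta> L \<alpha> \<Psi> H Hs \<longleftrightarrow>
     r > 0 \<and> \<beta> \<ge> 0 \<and> L > 0 \<and> 0 < \<alpha> \<and> \<alpha> < 1 \<and>
     (\<forall>u. \<exists>n. (\<Psi> ^^ n) u \<in> cball 0 r) \<and>
     \<Psi> ` cball 0 r \<subseteq> cball 0 r \<and>
     (\<forall>u\<in>cball 0 r. \<forall>v\<in>cball 0 r.
        (Vnorm \<beta> H Hs (\<Psi> u - \<Psi> v))\<^sup>2 \<le> L * (Vnorm \<beta> H Hs (u - v))\<^sup>2 \<and>
        (Vnorm \<beta> H Hs ((\<Psi> u - \<Psi> v) - Pop H Hs (\<Psi> u - \<Psi> v)))\<^sup>2
           \<le> \<alpha> * (Vnorm \<beta> H Hs (u - v))\<^sup>2)"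

definition kgain :: "('h::real_inner \<Rightarrow> real^'k) \<Rightarrow> (real^'k \<Rightarrow> 'h) \<Rightarrow> real \<Rightarrow> real^'k^'k
     \<Rightarrow> 'h op \<Rightarrow> real^'k \<Rightarrow> 'h" where
  "kgain H Hs \<epsilon> R S = (\<lambda>z. S (Hs (matrix_inv (matrix (\<lambda>w. H (S (Hs w))) + (\<epsilon>\<^sup>2) *\<^sub>R R) *v z)))"

definition gpf_step :: "('h::{real_inner,polish_space} \<Rightarrow> 'h) \<Rightarrow> real \<Rightarrow> real
     \<Rightarrow> ('h \<Rightarrow> real^'k) \<Rightarrow> (real^'k \<Rightarrow> 'h) \<Rightarrow> real \<Rightarrow> real^'k^'k \<Rightarrow> 'h op
     \<Rightarrow> 'h \<times> 'h op \<Rightarrow> real^'k \<Rightarrow> 'h \<times> 'h op" where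
  "gpf_step \<Psi> r \<beta> H Hs \<epsilon> R Q mC y =
     (let N = gauss (fst mC) (snd mC);
          f = (\<lambda>u. \<Psi> (projBV r \<beta> H Hs u));
          mu = integral\<^sup>L N f;
          Sig = (\<lambda>h. integral\<^sup>L N (\<lambda>u. ((f u - mu) \<bullet> h) *\<^sub>R (f u - mu)));
          S = (\<lambda>h. Sig h + Q h);
          K = kgain H Hs \<epsilon> R S
      in (mu + K (y - H mu), (\<lambda>h. S h - K (H (S h)))))"

primrec gpf :: "('h::{real_inner,polish_space} \<Rightarrow> 'h) \<Rightarrow> real \<Rightarrow> real
     \<Rightarrow> ('h \<Rightarrow> real^'k) \<Rightarrow> (real^'k \<Rightarrow> 'h) \<Rightarrow> real \<Rightarrow> real^'k^'k \<Rightarrow> 'h op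
     \<Rightarrow> 'h \<Rightarrow> 'h op \<Rightarrow> (nat \<Rightarrow> real^'k) \<Rightarrow> nat \<Rightarrow> 'h \<times> 'h op" where
  "gpf \<Psi> r \<beta> H Hs \<epsilon> R Q m0 C0 ys 0 = (m0, C0)"
| "gpf \<Psi> r \<beta> H Hs \<epsilon> R Q m0 C0 ys (Suc j) =
     gpf_step \<Psi> r \<beta> H Hs \<epsilon> R Q (gpf \<Psi> r \<beta> H Hs \<epsilon> R Q m0 C0 ys j) (ys (Suc j))"

definition noise_model :: "'w measure \<Rightarrow> (nat \<Rightarrow> 'w \<Rightarrow> real^'k) \<Rightarrow> real^'k^'k \<Rightarrow> bool" where
  "noise_model M \<eta> R \<longleftrightarrow> prob_space M \<and>
     prob_space.indep_vars M (\<lambda>_. borel) \<eta> {1..} \<and>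
     (\<forall>j\<ge>1. \<eta> j \<in> borel_measurable M \<and>
        integrable M (\<lambda>\<omega>. (norm (\<eta> j \<omega>))\<^sup>2) \<and>
        integral\<^sup>L M (\<eta> j) = 0 \<and>
        (\<forall>a b. integral\<^sup>L M (\<lambda>\<omega>. \<eta> j \<omega> $ a * \<eta> j \<omega> $ b) = R $ a $ b))"

end

theory Submission
  imports Defs
begin

text \<open>
  The posterior covariance of a Kalman update is below the one obtained with any other gain.
  Comparing with the gain \<open>H\<^sup>*\<close> shows that it is dominated, as a quadratic form, by
  \<open>(I - P) \<Sigma> (I - P) + \<epsilon>\<^sup>2 H\<^sup>* R H\<close>. The squeezing assumption bounds the trace of the first term
  by \<open>\<alpha>\<close> times the \<open>V\<close>-trace of the previous covariance, so these traces are eventually \<open>O(\<epsilon>\<^sup>2)\<close>.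
  Every bound on the update is pathwise, hence insensitive to the fact that the covariances
  depend on the noise. For the means, the unobserved part of the error is contracted by
  \<open>\<surd>\<alpha> + 4 r\<^sup>2 \<surd>L / a\<close>, which is below 1 for large \<open>a\<close>, while the observed part is \<open>O(\<epsilon>)\<close> because the
  inflation \<open>a P\<close> makes the observed covariance coercive.

  As the filter only sees Gaussian laws through a definite description, one also needs that a
  Gaussian measure with given mean and trace class covariance exists and is unique.
\<close>

section \<open>Hilbert space preliminaries\<close>

text \<open>Assumption A controls \<Psi> on the ball only, while Gaussian samples are unbounded. The
  projection bridges this: it is nonexpansive in the norm in which the assumption is stated, so the
  Lipschitz and squeezing bounds hold for \<open>f\<close> everywhere. Moreover \<open>f\<close>
  takes values in the ball, hence its deviation from its mean is at most \<open>2 * r\<close> and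
  the predicted covariance has operator norm at most \<open>4 * r\<^sup>2\<close>, whatever the
  previous covariance was. This is the source of every \<open>4 * r\<^sup>2\<close>, and it makes
  the trace finite after one step from an arbitrary Gaussian start. Large \<open>a\<close> does two
  jobs: it bounds the gain uniformly in \<epsilon> although R may be singular, and it damps the leak
  of observed error into unobserved directions to \<open>4 * r\<^sup>2 / a\<close>. It does not
  spoil the covariance bound, because the comparison gain cancels the inflation exactly. One
  constant must serve all \<epsilon> > 0, not only small ones. The time after which the asymptotic
  bounds hold may depend on \<epsilon> and on the signal, since the limsup ignores it.\<close>

text \<open>Cauchy-Schwarz for a semi-inner product. The quadratic in \<open>t\<close> below is
  nonnegative: take its minimiser, or, if its leading coefficient vanishes, use that an affine
  function bounded below is constant.\<close>

lemma psd_quadratic_le_imp_bilinear_sq_le: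
  fixes C :: "'a::real_inner \<Rightarrow> 'a"
  assumes lin: "linear C" and sym: "\<And>x y. C x \<bullet> y = x \<bullet> C y" and psd: "\<And>h. 0 \<le> C h \<bullet> h"
  shows "(C x \<bullet> y)\<^sup>2 \<le> (C x \<bullet> x) * (C y \<bullet> y)"
proof -
  have q: "0 \<le> C x \<bullet> x + 2 * t * (C x \<bullet> y) + t\<^sup>2 * (C y \<bullet> y)" for t
  proof -
    have "0 \<le> C (x + t *\<^sub>R y) \<bullet> (x + t *\<^sub>R y)" by (rule psd)
    also have "\<dots> = C x \<bullet> x + 2 * t * (C x \<bullet> y) + t\<^sup>2 * (C y \<bullet> y)"
      using sym[of y x]
      by (simp add: linear_add[OF lin] linear_scale[OF lin] inner_simps power2_eq_square inner_commute algebra_simps)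
    finally show ?thesis .
  qed
  show ?thesis
  proof (cases "C y \<bullet> y = 0")
    case True
    have "C x \<bullet> y = 0"
    proof (rule ccontr)
      assume n: "C x \<bullet> y \<noteq> 0"
      have "0 \<le> C x \<bullet> x + 2 * (- (C x \<bullet> x + 1) / (2 * (C x \<bullet> y))) * (C x \<bullet> y)"
        using q[of "- (C x \<bullet> x + 1) / (2 * (C x \<bullet> y))"] True by simp
      also have "\<dots> = -1" using n by (simp add: field_simps)
      finally show False by simp
    qed
    then show ?thesis using True by simp
  next
    case False
    then have pos: "0 < C y \<bullet> y" using psd[of y] by linarith
    have "0 \<le> C x \<bullet> x - (C x \<bullet> y)\<^sup>2 / (C y \<bullet> y)"
      using q[of "- (C x \<bullet> y) / (C y \<bullet> y)"] pos
      by (simp add: power2_eq_square field_simps)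
    then show ?thesis using pos by (simp add: field_simps)
  qed
qed

section \<open>Factorisation of positive operators\<close>

text \<open>A zero pivot makes the quotient 0, so the step changes nothing. This is harmless, as a
  positive remainder with zero pivot already vanishes at \<open>d n\<close>.\<close>

primrec cholesky :: "('a::real_inner \<Rightarrow> 'a) \<Rightarrow> (nat \<Rightarrow> 'a) \<Rightarrow> nat \<Rightarrow> 'a \<Rightarrow> 'a" where
  "cholesky C d 0 = C"
| "cholesky C d (Suc n) = (\<lambda>h. cholesky C d n h
     - ((cholesky C d n (d n) \<bullet> h) / (cholesky C d n (d n) \<bullet> d n)) *\<^sub>R cholesky C d n (d n))"

text \<open>Symmetric Gaussian elimination along a dense sequence factors \<open>C\<close> without spectral theory:
  each step subtracts the rank-one part that makes the remainder vanish at the next point.\<close>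
proposition psd_operator_series:
  fixes C :: "'a::{real_inner, second_countable_topology} \<Rightarrow> 'a"
  assumes lin: "linear C" and sym: "\<And>x y. C x \<bullet> y = x \<bullet> C y" and psd: "\<And>h. 0 \<le> C h \<bullet> h"
    and bd: "\<And>h. C h \<bullet> h \<le> b * (norm h)\<^sup>2"
  obtains a :: "nat \<Rightarrow> 'a" where "\<And>h. (\<lambda>n. (h \<bullet> a n)\<^sup>2) sums (C h \<bullet> h)"
proof -
  obtain D :: "'a set" where D: "countable D" "D \<noteq> {}"
    and dense: "\<And>U. open U \<Longrightarrow> U \<noteq> {} \<Longrightarrow> \<exists>y\<in>D. y \<in> U"
    by (metis countable_dense_exists equals0D open_UNIV UNIV_not_empty)
  define d where "d = from_nat_into D"
  have dD: "range d = D" using D by (simp add: d_def range_from_nat_into)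
  let ?C = "cholesky C d"
  \<comment> \<open>Normalised so that \<open>(h \<bullet> a n)\<^sup>2\<close> is exactly what step
    \<open>n\<close> removes from the quadratic form; a zero pivot gives
    \<open>a n = 0\<close>.\<close>
  define a where "a n = (1 / sqrt (?C n (d n) \<bullet> d n)) *\<^sub>R ?C n (d n)" for n
  have inv: "linear (?C n) \<and> (\<forall>x y. ?C n x \<bullet> y = x \<bullet> ?C n y) \<and> (\<forall>h. 0 \<le> ?C n h \<bullet> h)" for n
  proof (induction n)
    case 0 show ?case using assms by simp
  next
    case (Suc n)
    let ?x = "d n"
    have l: "linear (?C n)" and s: "\<And>x y. ?C n x \<bullet> y = x \<bullet> ?C n y" and p: "\<And>h. 0 \<le> ?C n h \<bullet> h"
      using Suc by auto
    have "linear (?C (Suc n))"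
      by (rule linearI) (simp_all add: linear_add[OF l] linear_scale[OF l] inner_simps
          add_divide_distrib algebra_simps)
    moreover have "?C (Suc n) x \<bullet> y = x \<bullet> ?C (Suc n) y" for x y
      using s[of x y] by (simp add: inner_simps inner_commute mult.commute)
    moreover have "0 \<le> ?C (Suc n) h \<bullet> h" for h
    proof (cases "?C n ?x \<bullet> ?x = 0")
      case True then show ?thesis using p[of h] by simp
    next
      case False
      then have pos: "0 < ?C n ?x \<bullet> ?x" using p[of ?x] by linarith
      have "(?C n ?x \<bullet> h)\<^sup>2 \<le> (?C n ?x \<bullet> ?x) * (?C n h \<bullet> h)"
        by (rule psd_quadratic_le_imp_bilinear_sq_le[OF l s p])
      then show ?thesis using pos
        by (simp add: inner_simps power2_eq_square field_simps)
    qed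
    ultimately show ?case by blast
  qed
  have l: "linear (?C n)" and s: "?C n x \<bullet> y = x \<bullet> ?C n y" and p: "0 \<le> ?C n h \<bullet> h" for n x y h
    using inv[of n] by auto
  have step: "?C (Suc n) h \<bullet> h = ?C n h \<bullet> h - (h \<bullet> a n)\<^sup>2" for n h
    using p[of n "d n"]
    by (simp add: a_def inner_simps power2_eq_square inner_commute)
  have psum: "(\<Sum>i<n. (h \<bullet> a i)\<^sup>2) = C h \<bullet> h - ?C n h \<bullet> h" for n h
    by (induction n) (use step in \<open>simp_all del: cholesky.simps(2)\<close>)
  have le: "?C n h \<bullet> h \<le> b * (norm h)\<^sup>2" for n h
    using psum[of h n] bd[of h] sum_nonneg[of "{..<n}" "\<lambda>i. (h \<bullet> a i)\<^sup>2"] by simp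
  \<comment> \<open>Zeros persist: if the remainder vanishes at \<open>d i\<close>, symmetry makes
    the next pivot vector orthogonal to \<open>d i\<close>.\<close>
  have zero: "i < n \<Longrightarrow> ?C n (d i) = 0" for i n
  proof (induction n)
    case 0 then show ?case by simp
  next
    case (Suc n)
    show ?case
    proof (cases "i < n")
      case True
      then have z: "?C n (d i) = 0" using Suc by simp
      then have "?C n (d n) \<bullet> d i = 0" using s[of n "d n" "d i"] by simp
      then show ?thesis using z by simp
    next
      case False
      then have i: "i = n" using Suc by simp
      show ?thesis
      proof (cases "?C n (d n) \<bullet> d n = 0")
        case True
        \<comment> \<open>Cauchy-Schwarz against the vector itself: a zero pivot forces the whole
          vector to vanish.\<close>
        have "(?C n (d n) \<bullet> ?C n (d n))\<^sup>2 \<le> (?C n (d n) \<bullet> d n) * (?C n (?C n (d n)) \<bullet> ?C n (d n))"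
          by (rule psd_quadratic_le_imp_bilinear_sq_le[OF l s p])
        then have "?C n (d n) = 0" using True by simp
        then show ?thesis using i by simp
      next
        case False then show ?thesis using i by simp
      qed
    qed
  qed
  \<comment> \<open>The remainders share the bound \<open>b\<close>, so replacing \<open>h\<close>
    by \<open>h - y\<close>, with \<open>y\<close> a nearby point at which the remainder vanishes,
    makes the form small for all later \<open>n\<close>.\<close>
  have tend: "(\<lambda>n. ?C n h \<bullet> h) \<longlonglongrightarrow> 0" for h
  proof (rule LIMSEQ_I)
    fix e :: real assume e: "0 < e"
    define t where "t = sqrt (e / (\<bar>b\<bar> + 1))"
    have t: "0 < t" using e by (simp add: t_def add_nonneg_pos)
    obtain y where y: "y \<in> D" "y \<in> ball h t"
      using dense[of "ball h t"] t by auto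
    then obtain i where i: "y = d i" using dD by auto
    have "norm (?C n h \<bullet> h - 0) < e" if n: "n \<ge> Suc i" for n
    proof -
      have z: "?C n y = 0" using zero[of i n] n i by simp
      have "?C n h \<bullet> h = ?C n (h - y) \<bullet> (h - y)"
        using z s[of n h y] by (simp add: linear_diff[OF l] inner_simps)
      also have "\<dots> \<le> b * (norm (h - y))\<^sup>2" by (rule le)
      also have "\<dots> \<le> (\<bar>b\<bar> + 1) * (norm (h - y))\<^sup>2" by (intro mult_right_mono) auto
      also have "\<dots> < (\<bar>b\<bar> + 1) * t\<^sup>2"
        using y t by (intro mult_strict_left_mono power_strict_mono) (auto simp: dist_norm)
      also have "\<dots> = e" using e by (simp add: t_def add_nonneg_pos)
      finally show ?thesis using p[of n h] by simp
    qed
    then show "\<exists>no. \<forall>n\<ge>no. norm (?C n h \<bullet> h - 0) < e" by blast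
  qed
  have "(\<lambda>n. (h \<bullet> a n)\<^sup>2) sums (C h \<bullet> h)" for h
    unfolding sums_def psum using tendsto_diff[OF tendsto_const tend[of h]] by simp
  then show ?thesis by (rule that)
qed

text \<open>Factorising the identity yields a Parseval frame, which takes the role of an orthonormal
  basis in all expansions of norms and traces.\<close>

corollary parseval_sequence:
  obtains e :: "nat \<Rightarrow> 'a::{real_inner, second_countable_topology}"
  where "\<And>h. (\<lambda>n. (h \<bullet> e n)\<^sup>2) sums (norm h)\<^sup>2"
proof (rule psd_operator_series[of "\<lambda>h::'a. h" 1])
  show "linear (\<lambda>h::'a. h)" by (rule linearI) auto
qed (use that in \<open>auto simp: power2_norm_eq_inner\<close>)

section \<open>Nearest points in convex sets\<close>

text \<open>A minimising sequence is Cauchy by the parallelogram law, since midpoints stay in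
  \<open>S\<close> and cannot beat the infimum.\<close>

lemma closest_point_exists:
  fixes S :: "'a::{real_inner, complete_space} set"
  assumes cl: "closed S" and cv: "convex S" and ne: "S \<noteq> {}"
  shows "\<exists>v\<in>S. \<forall>w\<in>S. norm (u - v) \<le> norm (u - w)"
proof -
  define D where "D = (INF w\<in>S. (norm (u - w))\<^sup>2)"
  have bb: "bdd_below ((\<lambda>w. (norm (u - w))\<^sup>2) ` S)" by (rule bdd_belowI[of _ 0]) auto
  have D_le: "D \<le> (norm (u - w))\<^sup>2" if "w \<in> S" for w
    unfolding D_def using bb that by (rule cINF_lower)
  have "\<exists>w\<in>S. (norm (u - w))\<^sup>2 < D + 1 / real (Suc n)" for n
    using cINF_less_iff[OF ne bb, of "D + 1 / real (Suc n)"] by (simp add: D_def)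
  then obtain w where w: "\<And>n. w n \<in> S" "\<And>n. (norm (u - w n))\<^sup>2 < D + 1 / real (Suc n)" by metis
  have par: "(norm (x - y))\<^sup>2 \<le> 2 * ((norm (u - x))\<^sup>2 - D) + 2 * ((norm (u - y))\<^sup>2 - D)"
    if "x \<in> S" "y \<in> S" for x y
  proof -
    have "(1/2) *\<^sub>R x + (1/2) *\<^sub>R y \<in> S" using cv that by (intro convexD) auto
    from D_le[OF this]
    have "4 * D \<le> (norm (2 *\<^sub>R (u - ((1/2) *\<^sub>R x + (1/2) *\<^sub>R y))))\<^sup>2" by (simp add: power_mult_distrib)
    also have "2 *\<^sub>R (u - ((1/2) *\<^sub>R x + (1/2) *\<^sub>R y)) = (u - x) + (u - y)"
      by (simp add: algebra_simps scaleR_2)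
    finally have "4 * D \<le> (norm ((u - x) + (u - y)))\<^sup>2" .
    moreover have "(norm ((u - x) + (u - y)))\<^sup>2 + (norm (x - y))\<^sup>2 = 2 * (norm (u - x))\<^sup>2 + 2 * (norm (u - y))\<^sup>2"
      by (simp add: power2_norm_eq_inner inner_simps inner_commute)
    ultimately show ?thesis by simp
  qed
  have "Cauchy w"
  proof (rule metric_CauchyI)
    fix e :: real assume e: "0 < e"
    obtain N where N: "1 / real (Suc N) < e\<^sup>2 / 4" using e by (metis nat_approx_posE zero_less_divide_iff zero_less_power zero_less_numeral)
    have "dist (w m) (w n) < e" if "m \<ge> N" "n \<ge> N" for m n
    proof -
      have "1 / real (Suc k) \<le> 1 / real (Suc N)" if "k \<ge> N" for k using that by (simp add: field_simps)
      then have "1 / real (Suc m) < e\<^sup>2 / 4" "1 / real (Suc n) < e\<^sup>2 / 4"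
        using N that by (meson le_less_trans)+
      then have "(norm (w m - w n))\<^sup>2 < e\<^sup>2"
        using par[OF w(1) w(1), of m n] w(2)[of m] w(2)[of n] by argo
      then show ?thesis using e by (simp add: dist_norm power2_less_imp_less)
    qed
    then show "\<exists>M. \<forall>m\<ge>M. \<forall>n\<ge>M. dist (w m) (w n) < e" by blast
  qed
  then obtain v where v: "w \<longlonglongrightarrow> v" using Cauchy_convergent_iff convergent_def by blast
  have vS: "v \<in> S" using cl w(1) v closed_sequentially by blast
  have "(norm (u - v))\<^sup>2 \<le> D"
  proof (rule LIMSEQ_le)
    show "(\<lambda>n. (norm (u - w n))\<^sup>2) \<longlonglongrightarrow> (norm (u - v))\<^sup>2" by (intro tendsto_intros v)
    have "(\<lambda>n. D + 1 / real (Suc n)) \<longlonglongrightarrow> D + 0"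
      by (intro tendsto_intros LIMSEQ_Suc[OF lim_1_over_n])
    then show "(\<lambda>n. D + 1 / real (Suc n)) \<longlonglongrightarrow> D" by simp
    show "\<exists>N. \<forall>n\<ge>N. (norm (u - w n))\<^sup>2 \<le> D + 1 / real (Suc n)" using w(2) less_imp_le by blast
  qed
  then have "\<forall>w\<in>S. norm (u - v) \<le> norm (u - w)"
    using D_le by (metis norm_ge_zero order_trans power2_le_imp_le)
  then show ?thesis using vS by blast
qed

lemma closest_point_variational:
  fixes S :: "'a::real_inner set"
  assumes "convex S" "v \<in> S" "\<forall>w\<in>S. norm (u - v) \<le> norm (u - w)" "w \<in> S"
  shows "(u - v) \<bullet> (w - v) \<le> 0"
proof (rule ccontr)
  define p where "p = (u - v) \<bullet> (w - v)"
  define q where "q = (norm (w - v))\<^sup>2"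
  assume "\<not> (u - v) \<bullet> (w - v) \<le> 0"
  then have p: "p > 0" by (simp add: p_def)
  then have q: "q > 0" unfolding q_def p_def by (metis inner_zero_right less_irrefl norm_eq_zero zero_less_norm_iff zero_less_power)
  \<comment> \<open>\<open>t \<le> 1\<close> keeps the moved point in \<open>S\<close>, and
    \<open>t * q \<le> p\<close> makes the linear gain exceed the quadratic loss.\<close>
  define t where "t = min 1 (p / q)"
  have t: "0 < t" "t \<le> 1" "t * q \<le> p" using p q by (auto simp: t_def min_def field_simps)
  have "(1 - t) *\<^sub>R v + t *\<^sub>R w \<in> S" using assms t by (intro convexD) auto
  then have "(norm (u - v))\<^sup>2 \<le> (norm (u - ((1 - t) *\<^sub>R v + t *\<^sub>R w)))\<^sup>2"
    using assms(3) by (simp add: power_mono)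
  also have "u - ((1 - t) *\<^sub>R v + t *\<^sub>R w) = (u - v) - t *\<^sub>R (w - v)"
    by (simp add: algebra_simps)
  also have "(norm \<dots>)\<^sup>2 = (norm (u - v))\<^sup>2 - 2 * t * p + t * (t * q)"
    unfolding p_def q_def power2_norm_eq_inner
    by (simp add: inner_simps inner_commute algebra_simps)
  finally have "2 * t * p \<le> t * (t * q)" by simp
  then have "2 * p \<le> t * q" using t by simp
  then show False using t p by simp
qed

text \<open>Sum of the two variational inequalities. With \<open>u = u'\<close> it also gives
  uniqueness of the nearest point.\<close>

lemma closest_points_nonexpansive:
  fixes S :: "'a::real_inner set"
  assumes cv: "convex S"
    and v: "v \<in> S" "\<forall>w\<in>S. norm (u - v) \<le> norm (u - w)"
    and v': "v' \<in> S" "\<forall>w\<in>S. norm (u' - v') \<le> norm (u' - w)"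
  shows "norm (v - v') \<le> norm (u - u')"
proof -
  have "(u - v) \<bullet> (v' - v) \<le> 0" "(u' - v') \<bullet> (v - v') \<le> 0"
    using closest_point_variational[OF cv v v'(1)] closest_point_variational[OF cv v' v(1)] by auto
  then have "(norm (v - v'))\<^sup>2 \<le> (u - u') \<bullet> (v - v')"
    by (simp add: power2_norm_eq_inner inner_simps inner_commute)
  also have "\<dots> \<le> norm (u - u') * norm (v - v')" by (rule norm_cauchy_schwarz)
  finally have "norm (v - v') * norm (v - v') \<le> norm (u - u') * norm (v - v')"
    by (simp only: power2_eq_square)
  then show ?thesis by (cases "v = v'") auto
qed

section \<open>Uniqueness from one-dimensional marginals\<close>

text \<open>Normalise the weight to a probability density and push it forward along
  \<open>g\<close>. The given integrals are the real and imaginary parts of the characteristic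
  function, so Levy's uniqueness theorem applies on the line. Zero mass cannot be normalised and is
  treated apart.\<close>

lemma (in prob_space) integral_restrict_eq_of_char_eq:
  fixes g w :: "'a \<Rightarrow> real"
  assumes N: "prob_space N" and sN: "sets N = sets M"
    and [measurable]: "g \<in> borel_measurable M" "w \<in> borel_measurable M"
    and w: "\<And>x. 0 \<le> w x" "\<And>x. w x \<le> b"
    and c: "\<And>t. (\<integral>x. w x * cos (t * g x) \<partial>M) = (\<integral>x. w x * cos (t * g x) \<partial>N)"
    and s: "\<And>t. (\<integral>x. w x * sin (t * g x) \<partial>M) = (\<integral>x. w x * sin (t * g x) \<partial>N)"
    and A: "A \<in> sets borel"
  shows "(\<integral>x. w x * indicator A (g x) \<partial>M) = (\<integral>x. w x * indicator A (g x) \<partial>N)"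
proof -
  interpret N: prob_space N by (rule N)
  note [measurable_cong] = sN
  note [measurable] = A
  have mass: "(\<integral>x. w x \<partial>M) = (\<integral>x. w x \<partial>N)" using c[of 0] by simp
  define m where "m = (\<integral>x. w x \<partial>M)"
  have iM: "integrable M w" using w by (intro integrable_const_bound[of _ b]) auto
  have iN: "integrable N w" using w by (intro N.integrable_const_bound[of _ b]) auto
  have m0: "0 \<le> m" unfolding m_def using w by (intro integral_nonneg_AE) auto
  have iM': "integrable M (\<lambda>x. w x * f x)" "integrable N (\<lambda>x. w x * f x)"
    if [measurable]: "f \<in> borel_measurable M" and "\<And>x. \<bar>f x\<bar> \<le> 1" for f
  proof -
    have *: "norm (w x * f x) \<le> b" for x
      using mult_mono[of "w x" b "\<bar>f x\<bar>" 1] w[of x] that(2)[of x] by (simp add: abs_mult)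
    show "integrable M (\<lambda>x. w x * f x)" by (intro integrable_const_bound[of _ b] AE_I2 *) measurable
    show "integrable N (\<lambda>x. w x * f x)" by (intro N.integrable_const_bound[of _ b] AE_I2 *) measurable
  qed
  show ?thesis
  proof (cases "m = 0")
    case True
    have "\<bar>\<integral>x. w x * indicator A (g x) \<partial>M\<bar> \<le> (\<integral>x. w x \<partial>M)"
      using w iM by (intro integral_abs_bound[THEN order_trans] integral_mono iM' integrable_abs)
         (auto simp: indicator_def)
    moreover have "\<bar>\<integral>x. w x * indicator A (g x) \<partial>N\<bar> \<le> (\<integral>x. w x \<partial>N)"
      using w iN by (intro integral_abs_bound[THEN order_trans] integral_mono iM' integrable_abs)
         (auto simp: indicator_def)
    ultimately show ?thesis using True mass by (simp add: m_def)
  next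
    case False
    then have mp: "0 < m" using m0 by simp
    have key: "real_distribution (distr (density K (\<lambda>x. ennreal (w x / m))) borel g)"
        "char (distr (density K (\<lambda>x. ennreal (w x / m))) borel g) t
           = Complex ((\<integral>x. w x * cos (t * g x) \<partial>K) / m) ((\<integral>x. w x * sin (t * g x) \<partial>K) / m)"
        "measure (distr (density K (\<lambda>x. ennreal (w x / m))) borel g) A = (\<integral>x. w x * indicator A (g x) \<partial>K) / m"
      if sK: "sets K = sets M" and K: "prob_space K" and mK: "(\<integral>x. w x \<partial>K) = m" and iK: "integrable K w" for K t
    proof -
      note [measurable_cong] = sK
      let ?D = "density K (\<lambda>x. ennreal (w x / m))"
      have "emeasure ?D (space ?D) = (\<integral>\<^sup>+x. ennreal (w x / m) \<partial>K)"
        by (subst emeasure_density) (auto intro!: nn_integral_cong)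
      also have "\<dots> = ennreal (\<integral>x. w x / m \<partial>K)"
        using w mp iK by (intro nn_integral_eq_integral) auto
      also have "\<dots> = 1" using mK mp by simp
      finally have P: "prob_space ?D" by (rule prob_spaceI)
      show "real_distribution (distr ?D borel g)"
        unfolding real_distribution_def real_distribution_axioms_def
        by (auto intro!: prob_space.prob_space_distr[OF P])
      have ii: "integrable K (\<lambda>x. (w x / m) *\<^sub>R iexp (t * g x))"
        using w mp by (intro Bochner_Integration.integrable_bound[OF iK[THEN integrable_divide, of m]])
           (auto intro!: AE_I2)
      have "char (distr ?D borel g) t = (\<integral>x. (w x / m) *\<^sub>R iexp (t * g x) \<partial>K)"
        unfolding char_def using w mp
        by (subst integral_distr) (auto intro!: integral_density)
      also have "\<dots> = Complex (\<integral>x. Re ((w x / m) *\<^sub>R iexp (t * g x)) \<partial>K) (\<integral>x. Im ((w x / m) *\<^sub>R iexp (t * g x)) \<partial>K)"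
        by (simp only: integral_Re[OF ii] integral_Im[OF ii] complex.collapse)
      also have "\<dots> = Complex ((\<integral>x. w x * cos (t * g x) \<partial>K) / m) ((\<integral>x. w x * sin (t * g x) \<partial>K) / m)"
        by (simp add: Re_exp Im_exp)
      finally show "char (distr ?D borel g) t
           = Complex ((\<integral>x. w x * cos (t * g x) \<partial>K) / m) ((\<integral>x. w x * sin (t * g x) \<partial>K) / m)" .
      have "measure (distr ?D borel g) A = (\<integral>x. indicator A x \<partial>distr ?D borel g)"
        by simp
      also have "\<dots> = (\<integral>x. (w x / m) *\<^sub>R indicator A (g x) \<partial>K)"
        using w mp by (subst integral_distr, simp, simp, subst integral_density) auto
      finally show "measure (distr ?D borel g) A = (\<integral>x. w x * indicator A (g x) \<partial>K) / m" by simp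
    qed
    note kM = key[OF refl prob_space_axioms m_def[symmetric] iM]
    note kN = key[OF sN N mass[folded m_def, symmetric] iN]
    have "distr (density M (\<lambda>x. ennreal (w x / m))) borel g = distr (density N (\<lambda>x. ennreal (w x / m))) borel g"
      by (intro Levy_uniqueness ext kM(1) kN(1)) (simp only: kM(2) kN(2) c s)
    then have "measure (distr (density M (\<lambda>x. ennreal (w x / m))) borel g) A
       = measure (distr (density N (\<lambda>x. ennreal (w x / m))) borel g) A" by simp
    then show ?thesis unfolding kM(3) kN(3) using mp by simp
  qed
qed

text \<open>Parseval writes norms as countable sums of squared coordinates, so balls lie in the
  generated sigma-algebra, and by Lindelof every open set is a countable union of balls. Indexing by
  lists makes intersection an append and the whole space the empty list.\<close>

lemma borel_eq_sigma_inner: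
  "sets (borel :: 'h::{real_inner, second_countable_topology} measure)
    = sigma_sets UNIV {{u. \<forall>(A, g)\<in>set xs. u \<bullet> g \<in> A} | xs. \<forall>(A, g)\<in>set xs. A \<in> sets borel}"
    (is "_ = sigma_sets UNIV ?G")
proof
  have "?G \<subseteq> sets borel"
  proof safe
    fix xs :: "(real set \<times> 'h) list"
    assume "\<forall>(A, g)\<in>set xs. A \<in> sets borel"
    moreover have "{u. u \<bullet> g \<in> A} \<in> sets borel" if "A \<in> sets borel" for A and g :: 'h
      using measurable_sets[of "\<lambda>u. u \<bullet> g" borel borel A] that by (simp add: vimage_def)
    ultimately have "(\<Inter>(A, g)\<in>set xs. {u. u \<bullet> g \<in> A}) \<in> sets borel" if "xs \<noteq> []"
      using that by (intro sets.finite_INT) auto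
    moreover have "{u. \<forall>(A, g)\<in>set xs. u \<bullet> g \<in> A} = (if xs = [] then UNIV else (\<Inter>(A, g)\<in>set xs. {u. u \<bullet> g \<in> A}))"
      by auto
    ultimately show "{u. \<forall>(A, g)\<in>set xs. u \<bullet> g \<in> A} \<in> sets borel" by simp
  qed
  then show "sigma_sets UNIV ?G \<subseteq> sets borel"
    using sets.sigma_sets_subset[of ?G borel] by simp
  define S where "S = sigma UNIV ?G"
  have sS: "sets S = sigma_sets UNIV ?G" "space S = UNIV" by (simp_all add: S_def)
  have [measurable]: "(\<lambda>u. u \<bullet> g) \<in> borel_measurable S" for g :: 'h
  proof (rule measurableI)
    fix A :: "real set" assume "A \<in> sets borel"
    then have "{u. u \<bullet> g \<in> A} \<in> ?G" by (auto intro!: exI[of _ "[(A, g)]"])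
    then show "(\<lambda>u. u \<bullet> g) -` A \<inter> space S \<in> sets S" by (auto simp: sS vimage_def)
  qed simp
  obtain e :: "nat \<Rightarrow> 'h" where e: "\<And>h. (\<lambda>n. (h \<bullet> e n)\<^sup>2) sums (norm h)\<^sup>2"
    using parseval_sequence by blast
  have n: "(\<lambda>u. norm (u - x)) \<in> borel_measurable S" for x :: 'h
  proof -
    have "norm (u - x) = sqrt (\<Sum>n. (u \<bullet> e n - x \<bullet> e n)\<^sup>2)" for u
      using sums_unique[OF e[of "u - x"]] by (intro real_sqrt_unique[symmetric]) (auto simp: inner_diff_left)
    then show ?thesis by simp
  qed
  have ball: "ball x r \<in> sets S" for x :: 'h and r
  proof -
    note [measurable] = n[of x]
    have "{u \<in> space S. norm (u - x) < r} \<in> sets S" by measurable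
    then show ?thesis by (simp add: sS ball_def dist_norm norm_minus_commute)
  qed
  have "U \<in> sets S" if "open U" for U :: "'h set"
  proof -
    define F where "F = {ball x r | x r. ball x r \<subseteq> U}"
    obtain F' where F': "F' \<subseteq> F" "countable F'" "\<Union>F' = \<Union>F"
      using Lindelof[of F] by (auto simp: F_def)
    have "U = \<Union>F"
      using that by (auto simp: F_def) (metis openE centre_in_ball)
    moreover have "\<Union>F' \<in> sets S"
      using F' ball by (intro sets.countable_Union) (auto simp: F_def)
    ultimately show ?thesis using F' by simp
  qed
  then have "sigma_sets UNIV {U::'h set. open U} \<subseteq> sets S"
    using sets.sigma_sets_subset[of "{U::'h set. open U}" S] sS by auto
  then show "sets (borel :: 'h measure) \<subseteq> sigma_sets UNIV ?G"
    by (simp add: borel_def sS)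
qed

text \<open>A form of the Cramer-Wold theorem. Multiplying a weight with known trigonometric integrals
  by the indicator of a set \<open>{u. u \<bullet> g \<in> A}\<close> keeps its trigonometric integrals known,
  which reduces the joint law to one-dimensional uniqueness, one coordinate at a time.\<close>
theorem measure_eqI_distr_inner:
  fixes M N :: "'h::{real_inner, second_countable_topology} measure"
  assumes M: "prob_space M" "sets M = sets borel" and N: "prob_space N" "sets N = sets borel"
    and eq: "\<And>h. distr M borel (\<lambda>u. u \<bullet> h) = distr N borel (\<lambda>u. u \<bullet> h)"
  shows "M = N"
proof -
  interpret M: prob_space M by (rule M)
  interpret N: prob_space N by (rule N)
  note [measurable_cong] = M(2) N(2)
  let ?X = "\<lambda>xs. {u :: 'h. \<forall>(A, g)\<in>set xs. u \<bullet> g \<in> A}"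
  let ?G = "{?X xs | xs. \<forall>(A, g)\<in>set xs. A \<in> sets borel}"
  have X[measurable]: "?X xs \<in> sets borel" if "\<forall>(A, g)\<in>set xs. A \<in> sets borel" for xs :: "(real set \<times> 'h) list"
    using that by (subst borel_eq_sigma_inner, intro sigma_sets.Basic) blast
  have same: "(\<integral>u. indicator (?X xs) u * cos (u \<bullet> h) \<partial>M) = (\<integral>u. indicator (?X xs) u * cos (u \<bullet> h) \<partial>N) \<and>
     (\<integral>u. indicator (?X xs) u * sin (u \<bullet> h) \<partial>M) = (\<integral>u. indicator (?X xs) u * sin (u \<bullet> h) \<partial>N)"
    if "\<forall>(A, g)\<in>set xs. A \<in> sets borel" for xs h
    using that
  proof (induction xs arbitrary: h)
    case Nil
    have "(\<integral>u. f (u \<bullet> h) \<partial>M) = (\<integral>u. f (u \<bullet> h) \<partial>N)" if [measurable]: "f \<in> borel_measurable borel" for f :: "real \<Rightarrow> real"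
      using integral_distr[of "\<lambda>u. u \<bullet> h" M borel f] integral_distr[of "\<lambda>u. u \<bullet> h" N borel f] eq[of h] by simp
    from this[of cos] this[of sin] show ?case by simp
  next
    case (Cons Ag xs)
    obtain A g where Ag: "Ag = (A, g)" by force
    have A[measurable]: "A \<in> sets borel" and xs: "\<forall>(A, g)\<in>set xs. A \<in> sets borel"
      using Cons.prems Ag by auto
    note [measurable] = X[OF xs]
    define W where "W = (indicator (?X xs) :: 'h \<Rightarrow> real)"
    have Wm[measurable]: "W \<in> borel_measurable borel" by (simp add: W_def)
    have W01: "0 \<le> W u" "W u \<le> 1" for u by (auto simp: W_def indicator_def)
    have IHc: "(\<integral>u. W u * cos (u \<bullet> h) \<partial>M) = (\<integral>u. W u * cos (u \<bullet> h) \<partial>N)"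
     and IHs: "(\<integral>u. W u * sin (u \<bullet> h) \<partial>M) = (\<integral>u. W u * sin (u \<bullet> h) \<partial>N)" for h
      using Cons.IH[OF xs] by (auto simp: W_def)
    have int: "integrable M (\<lambda>u. W u * f u)" "integrable N (\<lambda>u. W u * f u)"
      if [measurable]: "f \<in> borel_measurable borel" and "\<And>u. \<bar>f u\<bar> \<le> 1" for f
    proof -
      have *: "norm (W u * f u) \<le> 1" for u
        using mult_mono[of "W u" 1 "\<bar>f u\<bar>" 1] W01[of u] that(2)[of u] by (simp add: abs_mult)
      show "integrable M (\<lambda>x. W x * f x)" by (intro M.integrable_const_bound[of _ 1] AE_I2 *) measurable
      show "integrable N (\<lambda>x. W x * f x)" by (intro N.integrable_const_bound[of _ 1] AE_I2 *) measurable
    qed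
    \<comment> \<open>Weights must be nonnegative but \<open>cos\<close> and \<open>sin\<close>
      change sign. The shifted factor \<open>1 + f\<close> lies between 0 and 2; its constant part
      is removed afterwards by means of \<open>one\<close>.\<close>
    have restrict: "(\<integral>u. W u * (1 + f u) * indicator A (u \<bullet> g) \<partial>M) = (\<integral>u. W u * (1 + f u) * indicator A (u \<bullet> g) \<partial>N)"
      if [measurable]: "f \<in> borel_measurable borel" and f: "\<And>u. \<bar>f u\<bar> \<le> 1"
        and c: "\<And>t. (\<integral>u. W u * (f u * cos (t * (u \<bullet> g))) \<partial>M) = (\<integral>u. W u * (f u * cos (t * (u \<bullet> g))) \<partial>N)"
        and s: "\<And>t. (\<integral>u. W u * (f u * sin (t * (u \<bullet> g))) \<partial>M) = (\<integral>u. W u * (f u * sin (t * (u \<bullet> g))) \<partial>N)"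
      for f
    proof (rule M.integral_restrict_eq_of_char_eq[where b=2])
      show "prob_space N" "sets N = sets M" using N M by auto
      show "0 \<le> W u * (1 + f u)" for u using W01[of u] f[of u] by (intro mult_nonneg_nonneg) auto
      show "W u * (1 + f u) \<le> 2" for u
        using mult_mono[of "W u" 1 "1 + f u" 2] W01[of u] f[of u] by (simp add: abs_le_iff)
      have fp: "\<bar>f u * p\<bar> \<le> 1" if "\<bar>p\<bar> \<le> 1" for u p
        using mult_mono[of "\<bar>f u\<bar>" 1 "\<bar>p\<bar>" 1] f[of u] that by (simp add: abs_mult)
      have split: "(\<integral>u. W u * (1 + f u) * p u \<partial>M) = (\<integral>u. W u * p u \<partial>M) + (\<integral>u. W u * (f u * p u) \<partial>M)"
        "(\<integral>u. W u * (1 + f u) * p u \<partial>N) = (\<integral>u. W u * p u \<partial>N) + (\<integral>u. W u * (f u * p u) \<partial>N)"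
        if [measurable]: "p \<in> borel_measurable borel" and "\<And>u. \<bar>p u\<bar> \<le> 1" for p
      proof -
        have "W u * (1 + f u) * p u = W u * p u + W u * (f u * p u)" for u by (simp add: algebra_simps)
        then show "(\<integral>u. W u * (1 + f u) * p u \<partial>M) = (\<integral>u. W u * p u \<partial>M) + (\<integral>u. W u * (f u * p u) \<partial>M)"
         "(\<integral>u. W u * (1 + f u) * p u \<partial>N) = (\<integral>u. W u * p u \<partial>N) + (\<integral>u. W u * (f u * p u) \<partial>N)"
          using that fp by (auto intro!: Bochner_Integration.integral_add int)
      qed
      show "(\<integral>u. W u * (1 + f u) * cos (t * (u \<bullet> g)) \<partial>M) = (\<integral>u. W u * (1 + f u) * cos (t * (u \<bullet> g)) \<partial>N)" for t
        using IHc[of "t *\<^sub>R g"] c[of t] by (simp add: split)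
      show "(\<integral>u. W u * (1 + f u) * sin (t * (u \<bullet> g)) \<partial>M) = (\<integral>u. W u * (1 + f u) * sin (t * (u \<bullet> g)) \<partial>N)" for t
        using IHs[of "t *\<^sub>R g"] s[of t] by (simp add: split)
    qed simp_all
    have one: "(\<integral>u. W u * indicator A (u \<bullet> g) \<partial>M) = (\<integral>u. W u * indicator A (u \<bullet> g) \<partial>N)"
      using restrict[of "\<lambda>_. 0"] by simp
    have prod: "(\<integral>u. W u * (p u * indicator A (u \<bullet> g)) \<partial>M) = (\<integral>u. W u * (p u * indicator A (u \<bullet> g)) \<partial>N)"
      if [measurable]: "p \<in> borel_measurable borel" and "\<And>u. \<bar>p u\<bar> \<le> 1"
      and r: "(\<integral>u. W u * (1 + p u) * indicator A (u \<bullet> g) \<partial>M) = (\<integral>u. W u * (1 + p u) * indicator A (u \<bullet> g) \<partial>N)" for p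
    proof -
      have *: "W u * (1 + p u) * indicator A (u \<bullet> g) = W u * indicator A (u \<bullet> g) + W u * (p u * indicator A (u \<bullet> g))" for u
        by (simp add: algebra_simps)
      have [measurable]: "(\<lambda>u. indicator A (u \<bullet> g) :: real) \<in> borel_measurable borel" by measurable
      have b: "\<bar>indicator A (u \<bullet> g) :: real\<bar> \<le> 1" "\<bar>p u * indicator A (u \<bullet> g)\<bar> \<le> 1" for u
        using that(2)[of u] by (auto simp: indicator_def)
      show ?thesis using r one unfolding * using b
        by (subst (asm) (1 2) Bochner_Integration.integral_add) (auto intro!: int)
    qed
    \<comment> \<open>Product-to-sum formulas turn a frequency in direction \<open>h\<close> times
      one in direction \<open>g\<close> into single frequencies \<open>h + t g\<close> and
      \<open>h - t g\<close>, covered by the induction hypothesis.\<close>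
    have cc: "cos a * cos b = (cos (a + b) + cos (a - b)) / 2" "cos a * sin b = (sin (a + b) - sin (a - b)) / 2"
       "sin a * cos b = (sin (a + b) + sin (a - b)) / 2" "sin a * sin b = (cos (a - b) - cos (a + b)) / 2" for a b :: real
      by (simp_all add: cos_add cos_diff sin_add sin_diff)
    have lin: "(\<integral>u. W u * (p u + q u) \<partial>M) = (\<integral>u. W u * (p u + q u) \<partial>N)"
              "(\<integral>u. W u * (p u - q u) \<partial>M) = (\<integral>u. W u * (p u - q u) \<partial>N)"
      if [measurable]: "p \<in> borel_measurable borel" "q \<in> borel_measurable borel"
       and "\<And>u. \<bar>p u\<bar> \<le> 1" "\<And>u. \<bar>q u\<bar> \<le> 1" and eqs: "(\<integral>u. W u * p u \<partial>M) = (\<integral>u. W u * p u \<partial>N)"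
         "(\<integral>u. W u * q u \<partial>M) = (\<integral>u. W u * q u \<partial>N)" for p q
    proof -
      have i: "integrable M (\<lambda>u. W u * p u)" "integrable N (\<lambda>u. W u * p u)"
        "integrable M (\<lambda>u. W u * q u)" "integrable N (\<lambda>u. W u * q u)"
        using that by (auto intro!: int)
      show "(\<integral>u. W u * (p u + q u) \<partial>M) = (\<integral>u. W u * (p u + q u) \<partial>N)"
        "(\<integral>u. W u * (p u - q u) \<partial>M) = (\<integral>u. W u * (p u - q u) \<partial>N)"
        using i eqs by (simp_all add: distrib_left right_diff_distrib)
    qed
    have dist: "u \<bullet> h + t * (u \<bullet> g) = u \<bullet> (h + t *\<^sub>R g)" "u \<bullet> h - t * (u \<bullet> g) = u \<bullet> (h - t *\<^sub>R g)" for u t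
      by (simp_all add: inner_simps)
    have C: "(\<integral>u. W u * (cos (u \<bullet> h) * indicator A (u \<bullet> g)) \<partial>M) = (\<integral>u. W u * (cos (u \<bullet> h) * indicator A (u \<bullet> g)) \<partial>N)"
      by (intro prod restrict) (simp_all add: cc dist lin IHc IHs)
    have S: "(\<integral>u. W u * (sin (u \<bullet> h) * indicator A (u \<bullet> g)) \<partial>M) = (\<integral>u. W u * (sin (u \<bullet> h) * indicator A (u \<bullet> g)) \<partial>N)"
      by (intro prod restrict) (simp_all add: cc dist lin IHc IHs)
    have ind: "indicator (?X (Ag # xs)) u * p = W u * (p * indicator A (u \<bullet> g))" for u p
      by (auto simp: W_def Ag indicator_def)
    show ?case unfolding ind using C S by blast
  qed
  show ?thesis
  proof (rule measure_eqI_generator_eq[where E="?G" and \<Omega>=UNIV and A="\<lambda>_. UNIV"])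
    show "Int_stable ?G"
    proof (rule Int_stableI)
      fix a b assume "a \<in> ?G" "b \<in> ?G"
      then obtain xs ys where "a = ?X xs" "b = ?X ys"
        "\<forall>(A, g)\<in>set xs. A \<in> sets borel" "\<forall>(A, g)\<in>set ys. A \<in> sets borel" by auto
      then have "a \<inter> b = ?X (xs @ ys)" "\<forall>(A, g)\<in>set (xs @ ys). A \<in> sets borel" by auto
      then show "a \<inter> b \<in> ?G" by blast
    qed
    show "sets M = sigma_sets UNIV ?G" "sets N = sigma_sets UNIV ?G"
      unfolding M(2) N(2) by (rule borel_eq_sigma_inner)+
    show "emeasure M X = emeasure N X" if XG: "X \<in> ?G" for X
    proof -
      obtain xs where xs: "X = ?X xs" "\<forall>(A, g)\<in>set xs. A \<in> sets borel" using XG by blast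
      \<comment> \<open>At frequency 0 the cosine is 1, leaving the measure of the cylinder.\<close>
      have "measure M X = measure N X"
        using same[OF xs(2), of 0] X[OF xs(2)] xs(1) M(2) N(2) by simp
      then show ?thesis by (simp add: M.emeasure_eq_measure N.emeasure_eq_measure)
    qed
    show "range (\<lambda>_. UNIV) \<subseteq> ?G" by (auto intro!: exI[of _ "[]"])
  qed auto
qed

lemma gaussian_measure_unique:
  assumes "gaussian_measure m C \<mu>" "gaussian_measure m C \<nu>"
  shows "\<mu> = \<nu>"
proof (rule measure_eqI_distr_inner)
  show "distr \<mu> borel (\<lambda>u. u \<bullet> h) = distr \<nu> borel (\<lambda>u. u \<bullet> h)" for h
    using assms by (simp add: gaussian_measure_def)
qed (use assms in \<open>simp_all add: gaussian_measure_def\<close>)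

text \<open>Discharges the definite description: any measure with the right marginals may replace
  \<open>gauss\<close>.\<close>

lemma gauss_eq: "gaussian_measure m C \<mu> \<Longrightarrow> gauss m C = \<mu>"
  unfolding gauss_def using gaussian_measure_unique by (intro the_equality) auto

section \<open>Existence of Gaussian measures\<close>

definition normal_dist :: "real \<Rightarrow> real \<Rightarrow> real measure" where
  "normal_dist m v = (if v = 0 then return borel m else density lborel (normal_density m (sqrt v)))"

text \<open>As affine images of the standard normal law, the degenerate and nondegenerate cases need
  no further distinction in moment and characteristic function computations.\<close>

lemma normal_dist_eq_distr:
  assumes v: "0 \<le> v"
  shows "normal_dist m v = distr std_normal_distribution borel (\<lambda>z. m + sqrt v * z)"
proof -
  interpret S: real_distribution std_normal_distribution by (rule real_dist_normal_dist)
  show ?thesis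
  proof (cases "v = 0")
    case True
    then show ?thesis using S.distr_const[of m borel] by (simp add: normal_dist_def)
  next
    case False
    then have v: "0 < sqrt v" using assms by simp
    have "distributed std_normal_distribution lborel (\<lambda>x. x) std_normal_density"
      unfolding distributed_def by (auto intro!: distr_id2)
    from S.normal_density_affine[OF this, of "sqrt v" m] v
    have "distributed std_normal_distribution lborel (\<lambda>x. m + sqrt v * x) (normal_density m (sqrt v))"
      by simp
    from distributed_distr_eq_density[OF this] False
    have "normal_dist m v = distr std_normal_distribution lborel (\<lambda>x. m + sqrt v * x)"
      by (simp add: normal_dist_def)
    also have "\<dots> = distr std_normal_distribution borel (\<lambda>x. m + sqrt v * x)"
      by (rule distr_cong) auto
    finally show ?thesis .
  qed
qed

lemma real_distribution_normal_dist: "0 \<le> v \<Longrightarrow> real_distribution (normal_dist m v)"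
  using real_dist_normal_dist
  by (simp add: normal_dist_eq_distr real_distribution_def real_distribution_axioms_def prob_space.prob_space_distr)

lemma char_normal_dist:
  assumes "0 \<le> v"
  shows "char (normal_dist m v) t = iexp (t * m) * exp (- (t\<^sup>2 * v) / 2)"
proof -
  have "char (normal_dist m v) t = (CLINT z|std_normal_distribution. iexp (t * m) * iexp ((t * sqrt v) * z))"
    unfolding char_def normal_dist_eq_distr[OF assms]
    by (subst integral_distr) (auto simp: exp_add[symmetric] algebra_simps)
  also have "\<dots> = iexp (t * m) * char std_normal_distribution (t * sqrt v)"
    unfolding char_def by (rule integral_mult_right_zero)
  finally show ?thesis using assms
    by (simp add: char_std_normal_distribution power_mult_distrib exp_of_real)
qed

lemma nn_integral_normal_dist_square:
  assumes "0 \<le> v"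
  shows "(\<integral>\<^sup>+x. ennreal ((x - m)\<^sup>2) \<partial>normal_dist m v) = ennreal v"
proof -
  have "(\<integral>\<^sup>+x. ennreal ((x - m)\<^sup>2) \<partial>normal_dist m v) = (\<integral>\<^sup>+z. ennreal v * ennreal (z\<^sup>2) \<partial>std_normal_distribution)"
    unfolding normal_dist_eq_distr[OF assms] using assms
    by (subst nn_integral_distr) (auto simp: power_mult_distrib ennreal_mult')
  also have "\<dots> = ennreal v * (\<integral>\<^sup>+z. ennreal (z\<^sup>2) \<partial>std_normal_distribution)"
    by (rule nn_integral_cmult) simp
  also have "(\<integral>\<^sup>+z. ennreal (z\<^sup>2) \<partial>std_normal_distribution) = ennreal (LINT z|std_normal_distribution. z\<^sup>2)"
    using std_normal_distribution_even_moments(2)[of 1] by (intro nn_integral_eq_integral) auto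
  also have "(LINT z|std_normal_distribution. z\<^sup>2) = 1"
    using std_normal_distribution_even_moments(1)[of 1] by simp
  finally show ?thesis by simp
qed

lemma gaussian_measure_alt:
  "gaussian_measure m C \<mu> \<longleftrightarrow>
     linear C \<and> (\<forall>x y. C x \<bullet> y = x \<bullet> C y) \<and> (\<forall>h. 0 \<le> C h \<bullet> h) \<and>
     sets \<mu> = sets borel \<and> prob_space \<mu> \<and>
     (\<forall>h. distr \<mu> borel (\<lambda>u. u \<bullet> h) = normal_dist (m \<bullet> h) (C h \<bullet> h))"
  by (simp add: gaussian_measure_def normal_dist_def)

lemma gaussian_measure_second_moment:
  assumes G: "gaussian_measure m C \<mu>"
  shows "(\<integral>\<^sup>+u. ennreal (((u - m) \<bullet> h)\<^sup>2) \<partial>\<mu>) = ennreal (C h \<bullet> h)"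
proof -
  have [measurable_cong]: "sets \<mu> = sets borel" and psd: "0 \<le> C h \<bullet> h"
    and d: "distr \<mu> borel (\<lambda>u. u \<bullet> h) = normal_dist (m \<bullet> h) (C h \<bullet> h)"
    using G by (auto simp: gaussian_measure_alt)
  have "(\<integral>\<^sup>+u. ennreal (((u - m) \<bullet> h)\<^sup>2) \<partial>\<mu>) = (\<integral>\<^sup>+x. ennreal ((x - m \<bullet> h)\<^sup>2) \<partial>distr \<mu> borel (\<lambda>u. u \<bullet> h))"
    by (subst nn_integral_distr) (auto simp: inner_diff_left)
  also have "\<dots> = ennreal (C h \<bullet> h)"
    unfolding d by (rule nn_integral_normal_dist_square[OF psd])
  finally show ?thesis .
qed

text \<open>Turns mean squared norms into traces of covariances.\<close>

lemma nn_integral_norm_square_parseval: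
  fixes e :: "nat \<Rightarrow> 'h::{real_inner, second_countable_topology}"
  assumes e: "\<And>h. (\<lambda>n. (h \<bullet> e n)\<^sup>2) sums (norm h)\<^sup>2"
    and [measurable]: "f \<in> borel_measurable M"
  shows "(\<integral>\<^sup>+x. ennreal ((norm (f x))\<^sup>2) \<partial>M) = (\<Sum>n. \<integral>\<^sup>+x. ennreal ((f x \<bullet> e n)\<^sup>2) \<partial>M)"
proof -
  have "ennreal ((norm (f x))\<^sup>2) = (\<Sum>n. ennreal ((f x \<bullet> e n)\<^sup>2))" for x
    by (intro suminf_ennreal_eq[symmetric] e) simp
  then show ?thesis by (simp add: nn_integral_suminf)
qed

section \<open>White noise and random series in Hilbert space\<close>

abbreviation white_noise :: "(nat \<Rightarrow> real) measure" where
  "white_noise \<equiv> PiM UNIV (\<lambda>_. std_normal_distribution)"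

lemma prob_space_white_noise: "prob_space white_noise"
  using real_dist_normal_dist by (intro prob_space_PiM) (auto simp: real_distribution_def)

lemma distr_white_noise_component: "distr white_noise borel (\<lambda>\<omega>. \<omega> n) = std_normal_distribution"
proof -
  have "distr white_noise std_normal_distribution (\<lambda>\<omega>. \<omega> n) = std_normal_distribution"
    using real_dist_normal_dist by (intro distr_PiM_component) (auto simp: real_distribution_def)
  moreover have "distr white_noise std_normal_distribution (\<lambda>\<omega>. \<omega> n) = distr white_noise borel (\<lambda>\<omega>. \<omega> n)"
    by (rule distr_cong) auto
  ultimately show ?thesis by simp
qed

lemma measurable_white_noise [measurable]: "(\<lambda>\<omega>. \<omega> n) \<in> borel_measurable white_noise"
proof -
  have "(\<lambda>\<omega>. \<omega> n) \<in> white_noise \<rightarrow>\<^sub>M std_normal_distribution" by simp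
  then show ?thesis by (simp cong: measurable_cong_sets)
qed

lemma indep_vars_white_noise:
  "prob_space.indep_vars white_noise (\<lambda>_. borel) (\<lambda>n \<omega>. \<omega> n) UNIV"
proof -
  interpret W: prob_space white_noise by (rule prob_space_white_noise)
  have "distr white_noise (PiM UNIV (\<lambda>_. borel)) (\<lambda>\<omega>. \<lambda>i\<in>UNIV. \<omega> i) = distr white_noise white_noise (\<lambda>\<omega>. \<omega>)"
    by (rule distr_cong) (auto intro!: sets_PiM_cong)
  also have "\<dots> = PiM UNIV (\<lambda>i. distr white_noise borel (\<lambda>\<omega>. \<omega> i))"
    by (simp add: distr_white_noise_component)
  finally show ?thesis
    by (subst W.indep_vars_iff_distr_eq_PiM') auto
qed

lemma integral_white_noise_component:
  fixes f :: "real \<Rightarrow> 'b::{banach, second_countable_topology}"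
  assumes "f \<in> borel_measurable borel"
  shows "(LINT \<omega>|white_noise. f (\<omega> n)) = (LINT x|std_normal_distribution. f x)"
    and "integrable white_noise (\<lambda>\<omega>. f (\<omega> n)) \<longleftrightarrow> integrable std_normal_distribution f"
  using integral_distr[of "\<lambda>\<omega>. \<omega> n" white_noise borel f] integrable_distr_eq[of "\<lambda>\<omega>. \<omega> n" white_noise borel f] assms
  by (simp_all add: distr_white_noise_component)

lemma white_noise_correlation:
  shows "integrable white_noise (\<lambda>\<omega>. \<omega> i * \<omega> j)"
    and "(LINT \<omega>|white_noise. \<omega> i * \<omega> j) = (if i = j then 1 else 0)"
proof -
  interpret W: prob_space white_noise by (rule prob_space_white_noise)
  have "integrable white_noise (\<lambda>\<omega>. \<omega> i * \<omega> j) \<and> (LINT \<omega>|white_noise. \<omega> i * \<omega> j) = (if i = j then 1 else 0)"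
  proof (cases "i = j")
    case True
    then show ?thesis
      using integral_white_noise_component[of "\<lambda>x. x\<^sup>2" j] std_normal_distribution_even_moments[of 1]
      by (simp add: power2_eq_square)
  next
    case False
    have i: "integrable white_noise (\<lambda>\<omega>. \<omega> k)" for k
      using integral_white_noise_component(2)[of "\<lambda>x. x" k] integrable_std_normal_distribution_moment[of 1] by simp
    have z: "(LINT \<omega>|white_noise. \<omega> k) = 0" for k
      using integral_white_noise_component(1)[of "\<lambda>x. x" k] integral_std_normal_distribution_moment_odd[of 1] by simp
    have ind: "W.indep_vars (\<lambda>_. borel) (\<lambda>n \<omega>. \<omega> n) {i, j}"
      by (rule W.indep_vars_subset[OF indep_vars_white_noise]) simp
    show ?thesis
      using W.indep_vars_lebesgue_integral[OF _ ind i] W.indep_vars_integrable[OF _ ind i] False z by simp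
  qed
  then show "integrable white_noise (\<lambda>\<omega>. \<omega> i * \<omega> j)"
    "(LINT \<omega>|white_noise. \<omega> i * \<omega> j) = (if i = j then 1 else 0)" by auto
qed

lemma white_noise_block_second_moment:
  fixes a :: "nat \<Rightarrow> 'h::{real_inner, second_countable_topology}"
  assumes F: "finite F"
  shows "(\<integral>\<^sup>+\<omega>. ennreal ((norm (\<Sum>n\<in>F. \<omega> n *\<^sub>R a n))\<^sup>2) \<partial>white_noise) = ennreal (\<Sum>n\<in>F. (norm (a n))\<^sup>2)"
proof -
  have eq: "(norm (\<Sum>n\<in>F. \<omega> n *\<^sub>R a n))\<^sup>2 = (\<Sum>i\<in>F. \<Sum>j\<in>F. (\<omega> i * \<omega> j) * (a i \<bullet> a j))" for \<omega> :: "nat \<Rightarrow> real"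
    by (simp add: power2_norm_eq_inner inner_sum_left inner_sum_right sum_distrib_left inner_commute algebra_simps)
  have int: "integrable white_noise (\<lambda>\<omega>. (norm (\<Sum>n\<in>F. \<omega> n *\<^sub>R a n))\<^sup>2)"
    unfolding eq using white_noise_correlation(1) by auto
  have "(LINT \<omega>|white_noise. (norm (\<Sum>n\<in>F. \<omega> n *\<^sub>R a n))\<^sup>2)
      = (\<Sum>i\<in>F. \<Sum>j\<in>F. (if i = j then 1 else 0) * (a i \<bullet> a j))"
    unfolding eq using white_noise_correlation by (simp add: integral_sum)
  also have "\<dots> = (\<Sum>n\<in>F. (norm (a n))\<^sup>2)"
    using F by (simp add: power2_norm_eq_inner if_distrib[of "\<lambda>x. x * _"] cong: if_cong)
  finally show ?thesis using int by (simp add: nn_integral_eq_integral)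
qed

lemma char_white_noise_sum:
  assumes F: "finite F"
  shows "(CLINT \<omega>|white_noise. iexp (t * (\<Sum>n\<in>F. \<omega> n * c n))) = exp (- (t\<^sup>2 * (\<Sum>n\<in>F. (c n)\<^sup>2)) / 2)"
proof -
  interpret W: prob_space white_noise by (rule prob_space_white_noise)
  have comp: "char (distr white_noise borel (\<lambda>\<omega>. \<omega> n * c n)) t = complex_of_real (exp (- ((t * c n)\<^sup>2) / 2))" for n
  proof -
    have "char (distr white_noise borel (\<lambda>\<omega>. \<omega> n * c n)) t = (CLINT \<omega>|white_noise. iexp ((t * c n) * \<omega> n))"
      unfolding char_def by (subst integral_distr) (auto simp: mult.commute mult.left_commute)
    also have "\<dots> = char std_normal_distribution (t * c n)"
      unfolding char_def by (rule integral_white_noise_component(1)) measurable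
    finally show ?thesis by (simp add: char_std_normal_distribution exp_of_real)
  qed
  have "(CLINT \<omega>|white_noise. iexp (t * (\<Sum>n\<in>F. \<omega> n * c n)))
      = char (distr white_noise borel (\<lambda>\<omega>. \<Sum>n\<in>F. \<omega> n * c n)) t"
    unfolding char_def by (subst integral_distr) auto
  also have "\<dots> = (\<Prod>n\<in>F. char (distr white_noise borel (\<lambda>\<omega>. \<omega> n * c n)) t)"
  proof (rule W.char_distr_sum)
    show "W.indep_vars (\<lambda>_. borel) (\<lambda>n \<omega>. \<omega> n * c n) F"
      by (rule W.indep_vars_compose2[OF W.indep_vars_subset[OF indep_vars_white_noise]]) auto
  qed
  also have "\<dots> = (\<Prod>n\<in>F. complex_of_real (exp (- ((t * c n)\<^sup>2) / 2)))"
    by (simp only: comp)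
  also have "(\<Prod>n\<in>F. complex_of_real (exp (- ((t * c n)\<^sup>2) / 2))) = exp (- (t\<^sup>2 * (\<Sum>n\<in>F. (c n)\<^sup>2)) / 2)"
    by (simp only: of_real_prod[symmetric] exp_sum[OF F, symmetric])
       (simp add: power_mult_distrib sum_distrib_left sum_negf[symmetric] sum_divide_distrib)
  finally show ?thesis by simp
qed

lemma Cauchy_of_summable_increments:
  fixes S :: "nat \<Rightarrow> 'a::real_normed_vector"
  assumes "summable (\<lambda>k. norm (S (Suc k) - S k))"
  shows "Cauchy S"
proof (rule CauchyI')
  fix e :: real assume "0 < e"
  then obtain N where N: "\<And>m n. m \<ge> N \<Longrightarrow> norm (\<Sum>k\<in>{m..<n}. norm (S (Suc k) - S k)) < e"
    using assms unfolding summable_Cauchy by blast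
  have "dist (S m) (S n) < e" if "m \<ge> N" "m < n" for m n
  proof -
    have "S n - S m = (\<Sum>k\<in>{m..<n}. S (Suc k) - S k)" using that by (simp add: sum_Suc_diff')
    then have "norm (S n - S m) \<le> (\<Sum>k\<in>{m..<n}. norm (S (Suc k) - S k))" by (simp add: norm_sum)
    then show ?thesis using N[of m n] that by (simp add: dist_norm norm_minus_commute)
  qed
  then show "\<exists>M. \<forall>m\<ge>M. \<forall>n>m. dist (S m) (S n) < e" by blast
qed

text \<open>Blocks are cut so that block \<open>k\<close> has second moment at most
  \<open>(1/4)^k\<close>. Then the expected norms are summable and almost surely so are the norms.
  Passing to a subsequence of partial sums avoids any maximal inequality, and suffices because only
  the law of the limit matters.\<close>

lemma AE_Cauchy_white_noise_subseries:
  fixes a :: "nat \<Rightarrow> 'h::{real_inner, polish_space}"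
  assumes sm: "summable (\<lambda>n. (norm (a n))\<^sup>2)"
  obtains r :: "nat \<Rightarrow> nat" where "filterlim r at_top sequentially"
    "AE \<omega> in white_noise. Cauchy (\<lambda>k. \<Sum>n<r k. \<omega> n *\<^sub>R a n)"
proof -
  interpret W: prob_space white_noise by (rule prob_space_white_noise)
  have "\<exists>N. \<forall>m\<ge>N. \<forall>n. (\<Sum>i\<in>{m..<n}. (norm (a i))\<^sup>2) \<le> (1/4)^k" for k :: nat
  proof -
    obtain N where N: "\<And>m n. m \<ge> N \<Longrightarrow> norm (\<Sum>i\<in>{m..<n}. (norm (a i))\<^sup>2) < (1/4)^k"
      using sm unfolding summable_Cauchy by (metis zero_less_power zero_less_divide_1_iff zero_less_numeral)
    then show ?thesis by (metis abs_le_D1 less_imp_le real_norm_def)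
  qed
  then obtain N where N: "\<And>k m n. m \<ge> N k \<Longrightarrow> (\<Sum>i\<in>{m..<n}. (norm (a i))\<^sup>2) \<le> (1/4)^k" by metis
  \<comment> \<open>Accumulating the thresholds makes \<open>r\<close> monotone and at least both
    \<open>N k\<close> and \<open>k\<close>.\<close>
  define r where "r k = k + (\<Sum>i\<le>k. N i)" for k
  have rN: "N k \<le> r k" "k \<le> r k" "r k \<le> r (Suc k)" for k
    unfolding r_def using member_le_sum[of k "{..k}" N] by auto
  define S where "S k \<omega> = (\<Sum>n<r k. \<omega> n *\<^sub>R a n)" for k and \<omega> :: "nat \<Rightarrow> real"
  define D where "D k \<omega> = (\<Sum>n\<in>{r k..<r (Suc k)}. \<omega> n *\<^sub>R a n)" for k and \<omega> :: "nat \<Rightarrow> real"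
  have [measurable]: "D k \<in> borel_measurable white_noise" for k unfolding D_def by measurable
  have SD: "S (Suc k) \<omega> - S k \<omega> = D k \<omega>" for k \<omega>
    using sum.atLeastLessThan_concat[of 0 "r k" "r (Suc k)" "\<lambda>n. \<omega> n *\<^sub>R a n"] rN(3)[of k]
    by (simp add: S_def D_def lessThan_atLeast0 algebra_simps)
  \<comment> \<open>Young's inequality with weight \<open>2^k\<close> bounds the norm by its square;
    both resulting terms contribute half of \<open>(1/2)^k\<close>.\<close>
  have D1: "(\<integral>\<^sup>+\<omega>. ennreal (norm (D k \<omega>)) \<partial>white_noise) \<le> ennreal ((1/2)^k)" for k
  proof -
    have *: "norm (D k \<omega>) \<le> 2^k / 2 * (norm (D k \<omega>))\<^sup>2 + (1/2)^k / 2" for \<omega>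
    proof -
      have "0 \<le> (2^k * norm (D k \<omega>) - 1)\<^sup>2" by simp
      also have "\<dots> = 2^k * (2^k * (norm (D k \<omega>))\<^sup>2 - 2 * norm (D k \<omega>) + (1/2)^k)"
        by (simp add: power2_eq_square algebra_simps power_divide)
      finally have "0 \<le> 2^k * (norm (D k \<omega>))\<^sup>2 - 2 * norm (D k \<omega>) + (1/2)^k"
        by (metis zero_less_mult_pos not_less mult_less_0_iff zero_less_numeral zero_less_power)
      then show ?thesis by simp
    qed
    have "(\<integral>\<^sup>+\<omega>. ennreal (norm (D k \<omega>)) \<partial>white_noise)
      \<le> (\<integral>\<^sup>+\<omega>. ennreal (2^k / 2) * ennreal ((norm (D k \<omega>))\<^sup>2) + ennreal ((1/2)^k / 2) \<partial>white_noise)"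
      using * by (intro nn_integral_mono) (simp add: ennreal_mult'[symmetric] ennreal_plus[symmetric] del: ennreal_plus)
    also have "\<dots> = ennreal (2^k / 2) * (\<integral>\<^sup>+\<omega>. ennreal ((norm (D k \<omega>))\<^sup>2) \<partial>white_noise) + ennreal ((1/2)^k / 2)"
      by (subst nn_integral_add) (auto simp: nn_integral_cmult W.emeasure_space_1)
    also have "\<dots> \<le> ennreal (2^k / 2) * ennreal ((1/4)^k) + ennreal ((1/2)^k / 2)"
      unfolding D_def using N[OF rN(1)[of k]]
      by (intro add_right_mono mult_left_mono) (auto simp: white_noise_block_second_moment intro!: ennreal_leI)
    also have "\<dots> = ennreal (2^k / 2 * (1/4)^k + (1/2)^k / 2)"
      by (simp add: ennreal_mult'[symmetric] ennreal_plus[symmetric] del: ennreal_plus)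
    also have "2^k / 2 * (1/4)^k + (1/2)^k / 2 = ((1/2)^k :: real)"
    proof -
      have "(4::real)^k = 2^k * 2^k" by (simp flip: power_mult_distrib)
      then show ?thesis by (simp add: power_divide)
    qed
    finally show ?thesis .
  qed
  have "(\<integral>\<^sup>+\<omega>. (\<Sum>k. ennreal (norm (D k \<omega>))) \<partial>white_noise) = (\<Sum>k. \<integral>\<^sup>+\<omega>. ennreal (norm (D k \<omega>)) \<partial>white_noise)"
    by (rule nn_integral_suminf) measurable
  also have "\<dots> \<le> (\<Sum>k. ennreal ((1/2)^k))" by (intro suminf_le D1) auto
  also have "\<dots> = ennreal (\<Sum>k. (1/2)^k)" by (intro suminf_ennreal2) (auto simp: summable_geometric)
  also have "\<dots> < \<infinity>" by simp
  finally have "(\<integral>\<^sup>+\<omega>. (\<Sum>k. ennreal (norm (D k \<omega>))) \<partial>white_noise) \<noteq> \<infinity>" by simp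
  then have "AE \<omega> in white_noise. (\<Sum>k. ennreal (norm (D k \<omega>))) \<noteq> \<infinity>"
    by (intro nn_integral_PInf_AE) measurable
  then have "AE \<omega> in white_noise. Cauchy (\<lambda>k. \<Sum>n<r k. \<omega> n *\<^sub>R a n)"
  proof eventually_elim
    case (elim \<omega>)
    then have "summable (\<lambda>k. norm (D k \<omega>))" by (intro summable_suminf_not_top) auto
    then have "Cauchy (\<lambda>k. S k \<omega>)" by (intro Cauchy_of_summable_increments) (simp add: SD)
    then show ?case by (simp add: S_def)
  qed
  moreover have "filterlim r at_top sequentially"
    using rN(2) by (intro filterlim_at_top_mono[OF filterlim_ident]) auto
  ultimately show ?thesis using that by blast
qed

text \<open>The measure is the law of \<open>m\<close> plus the random series with coefficients
  \<open>a n\<close> from the factorisation of \<open>C\<close>; each marginal is identified by its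
  characteristic function.\<close>

proposition gaussian_measure_exists:
  fixes C :: "'h::{real_inner, polish_space} \<Rightarrow> 'h"
  assumes lin: "linear C" and sym: "\<And>x y. C x \<bullet> y = x \<bullet> C y" and psd: "\<And>h. 0 \<le> C h \<bullet> h"
    and bd: "\<And>h. C h \<bullet> h \<le> b * (norm h)\<^sup>2"
    and e: "\<And>h. (\<lambda>n. (h \<bullet> e n)\<^sup>2) sums (norm h)\<^sup>2"
    and tr: "summable (\<lambda>n. C (e n) \<bullet> e n)"
  shows "\<exists>\<mu>. gaussian_measure m C \<mu>"
proof -
  interpret W: prob_space white_noise by (rule prob_space_white_noise)
  obtain a :: "nat \<Rightarrow> 'h" where a: "\<And>h. (\<lambda>n. (h \<bullet> a n)\<^sup>2) sums (C h \<bullet> h)"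
    using psd_operator_series[OF lin sym psd bd] by blast
  \<comment> \<open>Expand each norm along \<open>e\<close> and exchange the sums: the inner sum
    over \<open>n\<close> is a partial sum of the series for
    \<open>C (e i) \<bullet> e i\<close>.\<close>
  have "(\<Sum>n<N. (norm (a n))\<^sup>2) \<le> (\<Sum>i. C (e i) \<bullet> e i)" for N
  proof -
    have s: "summable (\<lambda>i. (a n \<bullet> e i)\<^sup>2)" for n using e by (blast dest: sums_summable)
    have "(\<Sum>n<N. (norm (a n))\<^sup>2) = (\<Sum>n<N. \<Sum>i. (a n \<bullet> e i)\<^sup>2)"
      using sums_unique[OF e] by simp
    also have "\<dots> = (\<Sum>i. \<Sum>n<N. (a n \<bullet> e i)\<^sup>2)" using s by (intro suminf_sum[symmetric]) auto
    also have "\<dots> \<le> (\<Sum>i. C (e i) \<bullet> e i)"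
    proof (rule suminf_le)
      show "(\<Sum>n<N. (a n \<bullet> e i)\<^sup>2) \<le> C (e i) \<bullet> e i" for i
        using sum_le_suminf[OF sums_summable[OF a[of "e i"]], of "{..<N}"] sums_unique[OF a[of "e i"]]
        by (simp add: inner_commute)
      show "summable (\<lambda>i. \<Sum>n<N. (a n \<bullet> e i)\<^sup>2)" using s by (intro summable_sum) auto
    qed (rule tr)
    finally show ?thesis .
  qed
  then have "summable (\<lambda>n. (norm (a n))\<^sup>2)" by (intro summableI_nonneg_bounded) auto
  then obtain r where r: "filterlim r at_top sequentially"
    and conv: "AE \<omega> in white_noise. Cauchy (\<lambda>k. \<Sum>n<r k. \<omega> n *\<^sub>R a n)"
    using AE_Cauchy_white_noise_subseries by blast
  \<comment> \<open>Outside the convergence set the sums are replaced by \<open>m\<close>, so the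
    limit exists everywhere and is measurable.\<close>
  define S where "S k \<omega> = (if Cauchy (\<lambda>k. \<Sum>n<r k. \<omega> n *\<^sub>R a n) then m + (\<Sum>n<r k. \<omega> n *\<^sub>R a n) else m)"
    for k and \<omega> :: "nat \<Rightarrow> real"
  define X where "X \<omega> = lim (\<lambda>k. S k \<omega>)" for \<omega>
  have [measurable]: "S k \<in> borel_measurable white_noise" for k unfolding S_def by measurable
  have lim: "(\<lambda>k. S k \<omega>) \<longlonglongrightarrow> X \<omega>" for \<omega>
  proof -
    have "convergent (\<lambda>k. S k \<omega>)"
      by (cases "Cauchy (\<lambda>k. \<Sum>n<r k. \<omega> n *\<^sub>R a n)")
         (auto simp: S_def Cauchy_convergent_iff convergent_add_const_iff convergent_const)
    then show ?thesis by (simp add: X_def convergent_LIMSEQ_iff)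
  qed
  have [measurable]: "X \<in> borel_measurable white_noise"
    by (rule borel_measurable_LIMSEQ_metric[OF _ lim]) measurable
  have chr: "char (distr white_noise borel (\<lambda>\<omega>. X \<omega> \<bullet> h)) t = char (normal_dist (m \<bullet> h) (C h \<bullet> h)) t" for h t
  proof -
    have lim1: "(\<lambda>k. CLINT \<omega>|white_noise. iexp (t * (S k \<omega> \<bullet> h))) \<longlonglongrightarrow> (CLINT \<omega>|white_noise. iexp (t * (X \<omega> \<bullet> h)))"
    proof (rule integral_dominated_convergence[where w="\<lambda>_. 1"])
      show "AE \<omega> in white_noise. (\<lambda>k. iexp (t * (S k \<omega> \<bullet> h))) \<longlonglongrightarrow> iexp (t * (X \<omega> \<bullet> h))"
        by (intro AE_I2 tendsto_intros lim)
    qed auto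
    have Sk: "(CLINT \<omega>|white_noise. iexp (t * (S k \<omega> \<bullet> h)))
        = iexp (t * (m \<bullet> h)) * exp (- (t\<^sup>2 * (\<Sum>n<r k. (h \<bullet> a n)\<^sup>2)) / 2)" for k
    proof -
      have "(CLINT \<omega>|white_noise. iexp (t * (S k \<omega> \<bullet> h)))
         = (CLINT \<omega>|white_noise. iexp (t * (m \<bullet> h)) * iexp (t * (\<Sum>n<r k. \<omega> n * (h \<bullet> a n))))"
      proof (rule integral_cong_AE)
        show "AE \<omega> in white_noise. iexp (t * (S k \<omega> \<bullet> h)) = iexp (t * (m \<bullet> h)) * iexp (t * (\<Sum>n<r k. \<omega> n * (h \<bullet> a n)))"
          using conv
        proof eventually_elim
          case (elim \<omega>)
          have "S k \<omega> \<bullet> h = m \<bullet> h + (\<Sum>n<r k. \<omega> n * (h \<bullet> a n))"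
            using elim by (simp add: S_def inner_add_left inner_sum_left inner_commute[of h])
          then show ?case by (simp add: exp_add[symmetric] algebra_simps)
        qed
      qed measurable
      also have "\<dots> = iexp (t * (m \<bullet> h)) * exp (- (t\<^sup>2 * (\<Sum>n<r k. (h \<bullet> a n)\<^sup>2)) / 2)"
        by (simp only: integral_mult_right_zero char_white_noise_sum[OF finite_lessThan])
      finally show ?thesis .
    qed
    have lim2: "(\<lambda>k. iexp (t * (m \<bullet> h)) * exp (- (t\<^sup>2 * (\<Sum>n<r k. (h \<bullet> a n)\<^sup>2)) / 2))
       \<longlonglongrightarrow> iexp (t * (m \<bullet> h)) * exp (- (t\<^sup>2 * (C h \<bullet> h)) / 2)"
      using filterlim_compose[OF a[of h, unfolded sums_def] r] by (intro tendsto_intros) auto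
    have "(CLINT \<omega>|white_noise. iexp (t * (X \<omega> \<bullet> h))) = iexp (t * (m \<bullet> h)) * exp (- (t\<^sup>2 * (C h \<bullet> h)) / 2)"
      by (rule LIMSEQ_unique[OF lim1[unfolded Sk] lim2])
    moreover have "char (distr white_noise borel (\<lambda>\<omega>. X \<omega> \<bullet> h)) t = (CLINT \<omega>|white_noise. iexp (t * (X \<omega> \<bullet> h)))"
      unfolding char_def by (subst integral_distr) auto
    ultimately show ?thesis by (simp only: char_normal_dist[OF psd])
  qed
  have "distr white_noise borel (\<lambda>\<omega>. X \<omega> \<bullet> h) = normal_dist (m \<bullet> h) (C h \<bullet> h)" for h
    using chr psd by (intro Levy_uniqueness ext real_distribution_normal_dist)
      (auto simp: real_distribution_def real_distribution_axioms_def intro!: W.prob_space_distr)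
  then have "distr (distr white_noise borel X) borel (\<lambda>u. u \<bullet> h) = normal_dist (m \<bullet> h) (C h \<bullet> h)" for h
    by (subst distr_distr) (auto simp: comp_def)
  then have "gaussian_measure m C (distr white_noise borel X)"
    using lin sym psd by (auto simp: gaussian_measure_alt intro!: W.prob_space_distr)
  then show ?thesis by blast
qed

section \<open>Bochner integrals of bounded maps\<close>

text \<open>The state space has sort \<open>{real_inner, polish_space}\<close> rather than
  \<open>banach\<close>. The integral is therefore obtained directly: integrals of dominated simple
  approximations are Cauchy and completeness supplies the limit.\<close>

lemma integrable_bounded_complete_space:
  fixes f :: "'a \<Rightarrow> 'b::{real_normed_vector, complete_space, second_countable_topology}"
  assumes f[measurable]: "f \<in> borel_measurable M" and fin: "finite_measure M"
    and bd: "\<And>x. norm (f x) \<le> b"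
  shows "integrable M f"
proof -
  interpret finite_measure M by (rule fin)
  obtain s where s: "\<And>i. simple_function M (s i)"
    and lim: "\<And>x. x \<in> space M \<Longrightarrow> (\<lambda>i. s i x) \<longlonglongrightarrow> f x"
    and le: "\<And>i x. x \<in> space M \<Longrightarrow> dist (s i x) 0 \<le> 2 * dist (f x) 0"
    using borel_measurable_implies_sequence_metric[OF f, of 0] by blast
  have [measurable]: "s i \<in> borel_measurable M" for i using s by (rule borel_measurable_simple_function)
  have sb: "norm (s i x) \<le> 2 * b" if "x \<in> space M" for i x using le[OF that, of i] bd[of x] by simp
  have top: "(\<integral>\<^sup>+x. ennreal (2 * b) \<partial>M) < \<infinity>" by (simp add: ennreal_mult_less_top less_top[symmetric] ennreal_mult_eq_top_iff emeasure_finite[unfolded infinity_ennreal_def])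
  have si: "Bochner_Integration.simple_bochner_integrable M (s i)" for i
  proof (rule simple_bochner_integrableI_bounded[OF s])
    have "(\<integral>\<^sup>+x. ennreal (norm (s i x)) \<partial>M) \<le> (\<integral>\<^sup>+x. ennreal (2 * b) \<partial>M)"
      using sb by (intro nn_integral_mono ennreal_leI)
    then show "(\<integral>\<^sup>+x. ennreal (norm (s i x)) \<partial>M) < \<infinity>" using top by (rule le_less_trans)
  qed
  have L1: "(\<lambda>i. \<integral>\<^sup>+x. ennreal (norm (f x - s i x)) \<partial>M) \<longlonglongrightarrow> 0"
    using sb lim top by (intro nn_integral_dominated_convergence_norm[where w="\<lambda>_. 2 * b"]) auto
  have "Cauchy (\<lambda>i. Bochner_Integration.simple_bochner_integral M (s i))"
  proof (rule metric_CauchyI)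
    fix e :: real assume e: "0 < e"
    then obtain N where N: "\<And>n. n \<ge> N \<Longrightarrow> (\<integral>\<^sup>+x. ennreal (norm (f x - s n x)) \<partial>M) < ennreal (e / 2)"
      using order_tendstoD(2)[OF L1, of "ennreal (e / 2)"] by (auto simp: eventually_sequentially)
    have "dist (Bochner_Integration.simple_bochner_integral M (s m)) (Bochner_Integration.simple_bochner_integral M (s n)) < e" if "m \<ge> N" "n \<ge> N" for m n
    proof -
      have "ennreal (norm (Bochner_Integration.simple_bochner_integral M (s m) - Bochner_Integration.simple_bochner_integral M (s n)))
         \<le> (\<integral>\<^sup>+x. ennreal (norm (f x - s m x)) \<partial>M) + (\<integral>\<^sup>+x. ennreal (norm (f x - s n x)) \<partial>M)"
        by (rule simple_bochner_integral_bounded[OF f si si])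
      also have "\<dots> < ennreal (e / 2) + ennreal (e / 2)" by (intro add_strict_mono N that)
      also have "\<dots> = ennreal e" using e by (simp flip: ennreal_plus)
      finally show ?thesis using e by (simp add: dist_norm ennreal_less_iff)
    qed
    then show "\<exists>M'. \<forall>m\<ge>M'. \<forall>n\<ge>M'. dist (Bochner_Integration.simple_bochner_integral M (s m)) (Bochner_Integration.simple_bochner_integral M (s n)) < e" by blast
  qed
  then obtain z where z: "(\<lambda>i. Bochner_Integration.simple_bochner_integral M (s i)) \<longlonglongrightarrow> z"
    using Cauchy_convergent_iff convergent_def by blast
  have "has_bochner_integral M f z" by (rule has_bochner_integral.intros[OF f si L1 z])
  then show ?thesis by (rule integrable.intros)
qed

section \<open>The observation operator and the projected dynamics\<close>

locale observation =
  fixes H :: "'h::{real_inner, polish_space} \<Rightarrow> real^'k" and Hs :: "real^'k \<Rightarrow> 'h"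
  assumes bounded_linear_H: "bounded_linear H"
    and adj: "H u \<bullet> y = u \<bullet> Hs y"
    and H_Hs: "H (Hs y) = y"
begin

abbreviation P :: "'h \<Rightarrow> 'h" where "P \<equiv> Pop H Hs"

lemma linear_H: "linear H" using bounded_linear_H by (rule bounded_linear.linear)

lemmas H_simps = linear_add[OF linear_H] linear_diff[OF linear_H] linear_scale[OF linear_H] linear_0[OF linear_H]

lemma eq_if_inner: "(\<And>h. x \<bullet> h = y \<bullet> h) \<Longrightarrow> x = (y :: 'h)"
  by (metis eq_iff_diff_eq_0 inner_diff_left inner_eq_zero_iff)

lemma linear_Hs: "linear Hs"
  by (rule linearI; rule eq_if_inner) (simp_all add: inner_add_left inner_commute adj[symmetric] inner_add_right)

lemmas Hs_simps = linear_add[OF linear_Hs] linear_diff[OF linear_Hs] linear_scale[OF linear_Hs] linear_0[OF linear_Hs]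

lemma norm_Hs [simp]: "norm (Hs y) = norm y"
  using adj[of "Hs y" y] by (simp add: norm_eq_sqrt_inner H_Hs)

lemma P_eq: "P u = Hs (H u)" by (simp add: Pop_def)

lemma norm_P: "norm (P u) = norm (H u)" by (simp add: P_eq)

lemma norm_H_le: "norm (H u) \<le> norm u"
proof -
  have "norm (H u) * norm (H u) = u \<bullet> Hs (H u)"
    using adj[of u "H u"] by (simp add: power2_norm_eq_inner[symmetric] power2_eq_square)
  also have "\<dots> \<le> norm u * norm (H u)" using norm_cauchy_schwarz[of u "Hs (H u)"] by simp
  finally show ?thesis by (cases "H u = 0") auto
qed

lemma linear_P: "linear P"
  by (rule linearI) (simp_all add: P_eq H_simps Hs_simps)

lemmas P_simps = linear_add[OF linear_P] linear_diff[OF linear_P] linear_scale[OF linear_P] linear_0[OF linear_P]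

lemma P_sym: "P x \<bullet> y = x \<bullet> P y"
  by (simp add: P_eq inner_commute[of "Hs _"] adj[symmetric]) (simp add: adj inner_commute)

lemma H_P [simp]: "H (P u) = H u" and P_Hs [simp]: "P (Hs y) = Hs y" and H_compl [simp]: "H (u - P u) = 0"
  by (simp_all add: P_eq H_Hs H_simps)

lemma norm_split: "(norm u)\<^sup>2 = (norm (u - P u))\<^sup>2 + (norm (H u))\<^sup>2"
proof -
  have "(u - P u) \<bullet> P u = 0" by (simp add: P_eq adj[symmetric] H_simps H_Hs inner_diff_left)
  then have "(norm ((u - P u) + P u))\<^sup>2 = (norm (u - P u))\<^sup>2 + (norm (P u))\<^sup>2"
    by (simp only: power2_norm_eq_inner inner_add_left inner_add_right inner_commute[of "P u" "u - P u"])
  then show ?thesis by (simp add: norm_P)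
qed

lemma norm_compl_le: "norm (u - P u) \<le> norm u"
proof (rule power2_le_imp_le)
  show "(norm (u - P u))\<^sup>2 \<le> (norm u)\<^sup>2"
    using norm_split[of u] zero_le_power2[of "norm (H u)"] by linarith
qed (rule norm_ge_zero)

lemma bounded_linear_compl: "bounded_linear (\<lambda>u. u - P u)"
proof (rule bounded_linear_intro[where K=1])
  show "norm (u - P u) \<le> norm u * 1" for u using norm_compl_le by simp
qed (simp_all add: P_simps scaleR_diff_right)

lemma compl_sym: "(x - P x) \<bullet> y = x \<bullet> (y - P y)"
  by (simp add: inner_diff_left inner_diff_right P_sym)

end

section \<open>The V-norm and its projection onto the ball\<close>

locale lifted_observation = observation +
  fixes \<beta> :: real
  assumes beta: "0 \<le> \<beta>"
begin

abbreviation V :: "'a \<Rightarrow> real" where "V \<equiv> Vnorm \<beta> H Hs"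

text \<open>The \<open>V\<close>-norm is the norm of this image in a product space, which makes the \<open>V\<close>-projection
  an ordinary Hilbert space projection.\<close>
definition lift :: "'a \<Rightarrow> 'a \<times> (real^'b)" where "lift u = (u, sqrt \<beta> *\<^sub>R H u)"

lemma norm_lift: "norm (lift u) = V u"
  using beta by (simp add: lift_def Vnorm_def norm_P norm_Pair power_mult_distrib)

lemma bounded_linear_lift: "bounded_linear lift"
  unfolding lift_def using bounded_linear_H
  by (intro bounded_linear_Pair bounded_linear_ident bounded_linear_scaleR_right bounded_linear_compose[OF bounded_linear_scaleR_right])

lemmas lift_simps = linear_add[OF bounded_linear.linear[OF bounded_linear_lift]]
  linear_diff[OF bounded_linear.linear[OF bounded_linear_lift]]
  linear_scale[OF bounded_linear.linear[OF bounded_linear_lift]]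

lemma V_add: "V (x + y) \<le> V x + V y"
  using norm_triangle_ineq[of "lift x" "lift y"] by (simp add: norm_lift lift_simps flip: lift_simps)

lemma V_nonneg [simp]: "0 \<le> V x" by (simp flip: norm_lift)

lemma V_scale: "V (c *\<^sub>R x) = \<bar>c\<bar> * V x"
  by (simp add: lift_simps flip: norm_lift)

lemma V_square: "(V u)\<^sup>2 = (norm u)\<^sup>2 + \<beta> * (norm (H u))\<^sup>2"
  using beta by (simp add: Vnorm_def norm_P)

lemma norm_le_V: "norm u \<le> V u"
proof (rule power2_le_imp_le)
  show "(norm u)\<^sup>2 \<le> (V u)\<^sup>2" using beta by (simp add: V_square)
qed simp

lemma norm_H_le_V: "norm (H u) \<le> V u"
  using norm_H_le norm_le_V order_trans by blast

lemma V_le: "V u \<le> sqrt (1 + \<beta>) * norm u"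
proof (rule power2_le_imp_le)
  show "(V u)\<^sup>2 \<le> (sqrt (1 + \<beta>) * norm u)\<^sup>2"
    using mult_left_mono[OF power_mono[OF norm_H_le[of u] norm_ge_zero, of 2] beta] beta
    by (simp add: V_square power_mult_distrib algebra_simps)
qed (use beta in simp)

lemma V_compl: "V (u - P u) = norm (u - P u)"
  using beta by (simp add: Vnorm_def norm_P)

lemma V_P: "V (P u) = sqrt (1 + \<beta>) * norm (H u)"
proof -
  have "V (P u) = sqrt ((1 + \<beta>) * (norm (H u))\<^sup>2)"
    by (simp add: Vnorm_def norm_P distrib_right)
  then show ?thesis by (simp add: real_sqrt_mult)
qed

text \<open>The unobserved and the observed part are controlled by different mechanisms, squeezing
  and small residual; this recombines them.\<close>

lemma V_le_split: "V u \<le> norm (u - P u) + sqrt (1 + \<beta>) * norm (H u)"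
  using V_add[of "u - P u" "P u"] by (simp add: V_compl V_P)

text \<open>The image is the graph of a continuous map over a closed ball.\<close>

lemma closed_lift_cball: "closed (lift ` cball 0 r)"
proof -
  have "lift ` cball 0 r = {p. norm (fst p) \<le> r \<and> snd p = sqrt \<beta> *\<^sub>R H (fst p)}"
    by (auto simp: lift_def image_iff)
  moreover have "closed \<dots>"
    using bounded_linear.continuous_on[OF bounded_linear_H continuous_on_fst[OF continuous_on_id]]
    by (intro closed_Collect_conj closed_Collect_le closed_Collect_eq continuous_intros) auto
  ultimately show ?thesis by simp
qed

lemma convex_lift_cball: "convex (lift ` cball 0 r)"
  using bounded_linear.linear[OF bounded_linear_lift] by (intro convex_linear_image) auto

text \<open>Existence comes from the Hilbert projection in the product space. Uniqueness, required
  by the definite description, is nonexpansiveness at equal arguments, and \<open>lift\<close> is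
  injective.\<close>

lemma projBV_nearest:
  assumes r: "0 \<le> r"
  shows "projBV r \<beta> H Hs u \<in> cball 0 r"
    and "\<forall>w\<in>lift ` cball 0 r. norm (lift u - lift (projBV r \<beta> H Hs u)) \<le> norm (lift u - w)"
proof -
  have eq: "(\<forall>w\<in>cball 0 r. V (u - v) \<le> V (u - w)) \<longleftrightarrow> (\<forall>w\<in>lift ` cball 0 r. norm (lift u - lift v) \<le> norm (lift u - w))" for v
    by (simp add: norm_lift flip: lift_simps)
  have ne: "lift ` cball 0 r \<noteq> {}" using r by simp
  obtain v where v: "v \<in> cball 0 r" "\<forall>w\<in>lift ` cball 0 r. norm (lift u - lift v) \<le> norm (lift u - w)"
    using closest_point_exists[OF closed_lift_cball convex_lift_cball ne, of "lift u"] by blast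
  have "projBV r \<beta> H Hs u = v"
    unfolding projBV_def
  proof (rule the_equality)
    show "v \<in> cball 0 r \<and> (\<forall>w\<in>cball 0 r. V (u - v) \<le> V (u - w))" using v eq by blast
    fix v' assume "v' \<in> cball 0 r \<and> (\<forall>w\<in>cball 0 r. V (u - v') \<le> V (u - w))"
    then have v': "lift v' \<in> lift ` cball 0 r" "\<forall>w\<in>lift ` cball 0 r. norm (lift u - lift v') \<le> norm (lift u - w)"
      using eq by blast+
    have "norm (lift v' - lift v) \<le> norm (lift u - lift u)"
      by (rule closest_points_nonexpansive[OF convex_lift_cball v' imageI[OF v(1)] v(2)])
    then have "lift v' = lift v" by simp
    then show "v' = v" by (simp add: lift_def)
  qed
  then show "projBV r \<beta> H Hs u \<in> cball 0 r"
    "\<forall>w\<in>lift ` cball 0 r. norm (lift u - lift (projBV r \<beta> H Hs u)) \<le> norm (lift u - w)" using v by auto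
qed

lemma V_projBV_le:
  assumes r: "0 \<le> r"
  shows "V (projBV r \<beta> H Hs u - projBV r \<beta> H Hs v) \<le> V (u - v)"
  using closest_points_nonexpansive[OF convex_lift_cball imageI[OF projBV_nearest(1)[OF r]] projBV_nearest(2)[OF r]
      imageI[OF projBV_nearest(1)[OF r]] projBV_nearest(2)[OF r]]
  by (simp add: norm_lift flip: lift_simps)

lemma projBV_id:
  assumes "u \<in> cball 0 r"
  shows "projBV r \<beta> H Hs u = u"
proof -
  have "0 \<le> r" using assms norm_ge_zero[of u] by (simp del: norm_ge_zero)
  then have "norm (lift u - lift (projBV r \<beta> H Hs u)) \<le> norm (lift u - lift u)"
    using projBV_nearest(2) assms by blast
  then have "lift u = lift (projBV r \<beta> H Hs u)" by simp
  then show ?thesis by (simp add: lift_def)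
qed

end

section \<open>The projected dynamics\<close>

locale filter_setting = lifted_observation +
  fixes \<Psi> :: "'a \<Rightarrow> 'a" and r L \<alpha> :: real
  assumes r: "0 < r" and L: "0 < L" and alpha: "0 < \<alpha>" "\<alpha> < 1"
    and maps: "\<Psi> ` cball 0 r \<subseteq> cball 0 r"
    and Lip: "u \<in> cball 0 r \<Longrightarrow> v \<in> cball 0 r \<Longrightarrow> (V (\<Psi> u - \<Psi> v))\<^sup>2 \<le> L * (V (u - v))\<^sup>2"
    and squeeze: "u \<in> cball 0 r \<Longrightarrow> v \<in> cball 0 r \<Longrightarrow>
      (V ((\<Psi> u - \<Psi> v) - P (\<Psi> u - \<Psi> v)))\<^sup>2 \<le> \<alpha> * (V (u - v))\<^sup>2"
begin

definition f :: "'a \<Rightarrow> 'a" where "f u = \<Psi> (projBV r \<beta> H Hs u)"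

lemma norm_f_le: "norm (f u) \<le> r"
proof -
  have "f u \<in> cball 0 r"
    unfolding f_def using subsetD[OF maps imageI[OF projBV_nearest(1)[OF less_imp_le[OF r]]]] .
  then show ?thesis by (simp only: mem_cball_0)
qed

lemma f_eq: "u \<in> cball 0 r \<Longrightarrow> f u = \<Psi> u"
  by (simp add: f_def projBV_id)

lemma f_Lip: "V (f u - f v) \<le> sqrt L * V (u - v)"
proof -
  have "(V (f u - f v))\<^sup>2 \<le> L * (V (projBV r \<beta> H Hs u - projBV r \<beta> H Hs v))\<^sup>2"
    unfolding f_def using r by (intro Lip projBV_nearest(1)) auto
  also have "\<dots> \<le> L * (V (u - v))\<^sup>2"
    using L r by (intro mult_left_mono power_mono V_projBV_le) auto
  finally have "(V (f u - f v))\<^sup>2 \<le> (sqrt L * V (u - v))\<^sup>2" using L by (simp add: power_mult_distrib)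
  then show ?thesis by (rule power2_le_imp_le) (use L in simp)
qed

lemma f_squeeze: "norm ((f u - f v) - P (f u - f v)) \<le> sqrt \<alpha> * V (u - v)"
proof -
  have "(norm ((f u - f v) - P (f u - f v)))\<^sup>2 \<le> \<alpha> * (V (projBV r \<beta> H Hs u - projBV r \<beta> H Hs v))\<^sup>2"
    unfolding f_def V_compl[symmetric] using r by (intro squeeze projBV_nearest(1)) auto
  also have "\<dots> \<le> \<alpha> * (V (u - v))\<^sup>2"
    using alpha r by (intro mult_left_mono power_mono V_projBV_le) auto
  finally have "(norm ((f u - f v) - P (f u - f v)))\<^sup>2 \<le> (sqrt \<alpha> * V (u - v))\<^sup>2"
    using alpha by (simp add: power_mult_distrib)
  then show ?thesis by (rule power2_le_imp_le) (use alpha in simp)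
qed

lemma f_measurable [measurable]: "f \<in> borel_measurable borel"
proof (rule borel_measurable_continuous_onI)
  have "lipschitz_on (sqrt L * sqrt (1 + \<beta>)) UNIV f"
  proof (rule lipschitz_onI)
    fix u v
    have "norm (f u - f v) \<le> sqrt L * V (u - v)" using norm_le_V f_Lip order_trans by blast
    also have "\<dots> \<le> sqrt L * (sqrt (1 + \<beta>) * norm (u - v))"
      using L by (intro mult_left_mono V_le) auto
    finally show "dist (f u) (f v) \<le> sqrt L * sqrt (1 + \<beta>) * dist u v" by (simp add: dist_norm)
  qed (use L beta in simp)
  then show "continuous_on UNIV f" by (rule lipschitz_on_continuous_on)
qed

end

section \<open>The Kalman update\<close>

text \<open>Coercivity gives injectivity, hence in finite dimension a genuine inverse behind the
  choice in \<open>matrix_inv\<close>; Cauchy-Schwarz bounds its norm.\<close>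

lemma mult_matrix_inv_of_coercive:
  fixes B :: "real^'n^'n"
  assumes a: "0 < a" and co: "\<And>w. a * (norm w)\<^sup>2 \<le> (B *v w) \<bullet> w"
  shows "B *v (matrix_inv B *v z) = z" and "norm (matrix_inv B *v z) \<le> norm z / a"
proof -
  have "B *v w = 0 \<longrightarrow> w = 0" for w
  proof
    assume "B *v w = 0"
    then have "a * (norm w)\<^sup>2 \<le> 0" using co[of w] by simp
    then show "w = 0" using a by (simp add: mult_le_0_iff)
  qed
  then obtain B' where "B' ** B = mat 1" using matrix_left_invertible_ker[of B] by blast
  then have "B ** matrix_inv B = mat 1"
    unfolding matrix_inv_def using matrix_left_right_inverse[of B' B] by (metis (mono_tags, lifting) someI_ex)
  then show *: "B *v (matrix_inv B *v z) = z"
    by (simp add: matrix_vector_mul_assoc)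
  let ?x = "matrix_inv B *v z"
  have "a * (norm ?x)\<^sup>2 \<le> z \<bullet> ?x" using co[of ?x] * by simp
  also have "\<dots> \<le> norm z * norm ?x" by (rule norm_cauchy_schwarz)
  finally have "(a * norm ?x) * norm ?x \<le> norm z * norm ?x" by (simp add: power2_eq_square)
  then have "a * norm ?x \<le> norm z" by (cases "?x = 0") auto
  then show "norm ?x \<le> norm z / a" using a by (simp add: field_simps)
qed

locale kalman_update = observation H Hs
  for H :: "'h::{real_inner, polish_space} \<Rightarrow> real^'k" and Hs :: "real^'k \<Rightarrow> 'h" +
  fixes Sig :: "'h \<Rightarrow> 'h" and R :: "real^'k^'k" and a \<epsilon> b \<rho> :: real
  assumes a: "0 < a" and eps: "0 < \<epsilon>"
    and linear_Sig: "linear Sig" and Sig_sym: "Sig x \<bullet> y = x \<bullet> Sig y" and Sig_psd: "0 \<le> Sig h \<bullet> h"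
    and Sig_bound: "norm (Sig h) \<le> b * norm h"
    and R_sym: "(R *v p) \<bullet> q = p \<bullet> (R *v q)" and R_psd: "0 \<le> (R *v p) \<bullet> p"
    and R_bound: "norm (R *v p) \<le> \<rho> * norm p"
    and b: "0 \<le> b" and rho: "0 \<le> \<rho>"
begin

definition S :: "'h \<Rightarrow> 'h" where "S h = Sig h + a *\<^sub>R P h"

definition innovation :: "real^'k^'k" where
  "innovation = matrix (\<lambda>w. H (S (Hs w))) + \<epsilon>\<^sup>2 *\<^sub>R R"

definition solve :: "real^'k \<Rightarrow> real^'k" where "solve z = matrix_inv innovation *v z"

definition gain :: "real^'k \<Rightarrow> 'h" where "gain z = S (Hs (solve z))"

definition posterior :: "'h \<Rightarrow> 'h" where "posterior h = S h - gain (H (S h))"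

lemma kgain_eq: "kgain H Hs \<epsilon> R (\<lambda>h. Sig h + a *\<^sub>R P h) = gain"
  by (simp add: fun_eq_iff kgain_def gain_def solve_def innovation_def S_def)

lemmas Sig_simps = linear_add[OF linear_Sig] linear_diff[OF linear_Sig] linear_scale[OF linear_Sig]

lemma linear_S: "linear S"
  by (rule linearI) (simp_all add: S_def Sig_simps P_simps algebra_simps)

lemmas S_simps = linear_add[OF linear_S] linear_diff[OF linear_S] linear_scale[OF linear_S]

lemma S_sym: "S x \<bullet> y = x \<bullet> S y"
  by (simp add: S_def inner_add_left inner_add_right Sig_sym P_sym)

lemma innovation_mult: "innovation *v w = H (Sig (Hs w)) + a *\<^sub>R w + \<epsilon>\<^sup>2 *\<^sub>R (R *v w)"
proof -
  have "linear (\<lambda>w. H (S (Hs w)))"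
    using linear_compose[OF linear_compose[OF linear_Hs linear_S] linear_H] by (simp add: comp_def)
  then have "matrix (\<lambda>w. H (S (Hs w))) *v w = H (S (Hs w))"
    by (intro matrix_works) (simp add: linear_matrix_vector_mul_eq)
  then show ?thesis
    by (simp add: innovation_def S_def matrix_vector_mult_add_rdistrib scaleR_matrix_vector_assoc[symmetric] H_simps H_Hs)
qed

lemma innovation_sym: "(innovation *v x) \<bullet> y = x \<bullet> (innovation *v y)"
proof -
  have "H (Sig (Hs x)) \<bullet> y = x \<bullet> H (Sig (Hs y))"
    by (metis adj Sig_sym inner_commute)
  then show ?thesis
    by (simp add: innovation_mult inner_add_left inner_add_right R_sym)
qed

text \<open>The predicted covariance and R are only semidefinite. The constant \<open>a\<close>
  comes from the inflation alone, so it does not degenerate as \<epsilon> tends to 0.\<close>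

lemma innovation_coercive: "a * (norm w)\<^sup>2 \<le> (innovation *v w) \<bullet> w"
  using Sig_psd[of "Hs w"] R_psd[of w] eps
  by (simp add: innovation_mult inner_add_left adj power2_norm_eq_inner)

lemma innovation_solve: "innovation *v (solve z) = z" and norm_solve_le: "norm (solve z) \<le> norm z / a"
  using mult_matrix_inv_of_coercive[OF a innovation_coercive] by (simp_all add: solve_def)

lemma linear_solve: "linear solve"
  unfolding solve_def by (rule matrix_vector_mul_linear)

lemmas solve_simps = linear_add[OF linear_solve] linear_diff[OF linear_solve] linear_scale[OF linear_solve]

lemma gain_simps: "gain (x + y) = gain x + gain y" "gain (c *\<^sub>R x) = c *\<^sub>R gain x"
  by (simp_all add: gain_def solve_simps Hs_simps S_simps)

lemma norm_Sig_Hs_solve_le: "norm (Sig (Hs (solve z))) \<le> b / a * norm z"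
proof -
  have "norm (Sig (Hs (solve z))) \<le> b * norm (solve z)" using Sig_bound[of "Hs (solve z)"] by simp
  also have "\<dots> \<le> b * (norm z / a)" using b norm_solve_le by (rule mult_left_mono[rotated])
  finally show ?thesis by simp
qed

text \<open>The covariance part contributes \<open>b / a\<close> and the inflation part
  \<open>a\<close> times a vector of size \<open>norm z / a\<close>; neither involves
  \<epsilon>.\<close>

lemma norm_gain_le: "norm (gain z) \<le> (b / a + 1) * norm z"
proof -
  have *: "a * norm (solve z) \<le> norm z" using norm_solve_le[of z] a by (simp add: field_simps)
  have "norm (gain z) \<le> norm (Sig (Hs (solve z))) + norm (a *\<^sub>R Hs (solve z))"
    unfolding gain_def S_def P_Hs by (rule norm_triangle_ineq)
  also have "\<dots> \<le> b / a * norm z + norm z"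
    using * a norm_Sig_Hs_solve_le[of z] by (intro add_mono) simp_all
  finally show ?thesis by (simp add: distrib_right)
qed

text \<open>The inflation maps into the range of \<open>P\<close>, so off that range the gain only
  sees \<open>Sig\<close>. This yields the factor that large \<open>a\<close> makes small.\<close>

lemma norm_gain_compl_le: "norm (gain z - P (gain z)) \<le> b / a * norm z"
proof -
  have "gain z - P (gain z) = Sig (Hs (solve z)) - P (Sig (Hs (solve z)))"
    by (simp add: gain_def S_def P_simps)
  then show ?thesis using norm_compl_le norm_Sig_Hs_solve_le order_trans by metis
qed

text \<open>The residual is \<open>\<epsilon>\<^sup>2 R\<close> applied to a bounded vector. It is also bounded uniformly in \<open>\<epsilon>\<close>,
  and the two bounds together give one that is linear in \<open>\<epsilon>\<close>.\<close>
lemma norm_residual_le: "norm (z - H (gain z)) \<le> (\<rho> / a + b / a + 2) * \<epsilon> * norm z"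
proof -
  \<comment> \<open>The equation \<open>innovation *v solve z = z\<close> rearranged, as
    \<open>H (gain z)\<close> is its part without R.\<close>
  have eq: "z - H (gain z) = \<epsilon>\<^sup>2 *\<^sub>R (R *v solve z)"
    using innovation_solve[of z] by (simp add: innovation_mult gain_def S_def H_simps H_Hs algebra_simps)
  have "norm (z - H (gain z)) \<le> \<epsilon>\<^sup>2 * (\<rho> * norm (solve z))"
    unfolding eq using R_bound[of "solve z"] by (simp add: mult_left_mono)
  also have "\<dots> \<le> \<epsilon>\<^sup>2 * (\<rho> * (norm z / a))"
    using norm_solve_le rho by (intro mult_left_mono) auto
  finally have small: "norm (z - H (gain z)) \<le> \<epsilon>\<^sup>2 * (\<rho> / a * norm z)" by simp
  have "norm (z - H (gain z)) \<le> norm z + norm (gain z)"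
    using norm_triangle_ineq4[of z "H (gain z)"] norm_H_le[of "gain z"] by simp
  also have "\<dots> \<le> (b / a + 2) * norm z" using norm_gain_le[of z] by (simp add: algebra_simps)
  finally have large: "norm (z - H (gain z)) \<le> (b / a + 2) * norm z" .
  have nn: "0 \<le> \<rho> / a * norm z" "0 \<le> (b / a + 2) * norm z" using rho a b by simp_all
  have split: "(\<rho> / a + b / a + 2) * \<epsilon> * norm z = \<epsilon> * (\<rho> / a * norm z) + \<epsilon> * ((b / a + 2) * norm z)"
    by (simp add: algebra_simps)
  show ?thesis
  proof (cases "\<epsilon> \<le> 1")
    case True
    then have "\<epsilon>\<^sup>2 \<le> \<epsilon>" using eps by (simp add: power2_eq_square mult_left_le)
    then have "\<epsilon>\<^sup>2 * (\<rho> / a * norm z) \<le> \<epsilon> * (\<rho> / a * norm z)" using nn(1) by (rule mult_right_mono)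
    moreover have "0 \<le> \<epsilon> * ((b / a + 2) * norm z)" by (rule mult_nonneg_nonneg[OF less_imp_le[OF eps] nn(2)])
    ultimately show ?thesis using small split by linarith
  next
    case False
    then have "1 * ((b / a + 2) * norm z) \<le> \<epsilon> * ((b / a + 2) * norm z)" using nn(2) by (intro mult_right_mono) auto
    moreover have "0 \<le> \<epsilon> * (\<rho> / a * norm z)" by (rule mult_nonneg_nonneg[OF less_imp_le[OF eps] nn(1)])
    ultimately show ?thesis using large split by linarith
  qed
qed

lemma linear_posterior: "linear posterior"
  by (rule linearI) (simp_all add: posterior_def S_simps H_simps gain_simps algebra_simps)

lemma gain_inner: "gain z \<bullet> g = solve z \<bullet> H (S g)"
  unfolding gain_def by (metis S_sym inner_commute adj)

text \<open>The subtracted term is the symmetric form of \<open>innovation\<close> evaluated at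
  \<open>solve (H (S x))\<close> and \<open>solve (H (S y))\<close>.\<close>

lemma posterior_sym: "posterior x \<bullet> y = x \<bullet> posterior y"
proof -
  have "gain (H (S x)) \<bullet> y = solve (H (S x)) \<bullet> (innovation *v solve (H (S y)))"
    by (simp add: gain_inner innovation_solve)
  also have "\<dots> = gain (H (S y)) \<bullet> x"
    by (metis innovation_sym innovation_solve gain_inner inner_commute)
  finally show ?thesis by (simp add: posterior_def inner_diff_left inner_diff_right S_sym inner_commute[of x])
qed

text \<open>The left-hand side is the error variance in direction \<open>h\<close> of an arbitrary linear update;
  its minimum over \<open>w\<close> is the posterior variance.\<close>
lemma posterior_complete_square:
  "S (h - Hs w) \<bullet> (h - Hs w) + \<epsilon>\<^sup>2 * ((R *v w) \<bullet> w)
     = posterior h \<bullet> h + (innovation *v (w - solve (H (S h)))) \<bullet> (w - solve (H (S h)))"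
proof -
  define z where "z = H (S h)"
  define x where "x = solve z"
  have Bx: "innovation *v x = z" by (simp add: x_def innovation_solve)
  have cross: "S h \<bullet> Hs w = z \<bullet> w" "S (Hs w) \<bullet> h = z \<bullet> w"
    by (simp_all add: z_def adj S_sym inner_commute[of "Hs w"])
  have Bw: "(innovation *v w) \<bullet> w = S (Hs w) \<bullet> Hs w + \<epsilon>\<^sup>2 * ((R *v w) \<bullet> w)"
    by (simp add: innovation_mult S_def adj[symmetric] inner_add_left H_simps H_Hs)
  have "posterior h \<bullet> h = S h \<bullet> h - z \<bullet> x"
    by (simp add: posterior_def gain_inner inner_diff_left z_def x_def) (rule inner_commute)
  moreover have "(innovation *v (w - x)) \<bullet> (w - x) = (innovation *v w) \<bullet> w - 2 * (z \<bullet> w) + z \<bullet> x"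
    using innovation_sym[of w x]
    by (simp add: matrix_vector_mult_diff_distrib inner_diff_left inner_diff_right Bx inner_commute)
  moreover have "S (h - Hs w) \<bullet> (h - Hs w) = S h \<bullet> h - 2 * (z \<bullet> w) + S (Hs w) \<bullet> Hs w"
    by (simp add: S_simps inner_diff_left inner_diff_right cross)
  ultimately show ?thesis using Bw unfolding z_def[symmetric] x_def[symmetric] by simp
qed

text \<open>Completing the square at its minimiser \<open>w = solve (H (S h))\<close> exhibits the
  posterior variance as a sum of nonnegative terms.\<close>

lemma posterior_psd: "0 \<le> posterior h \<bullet> h"
proof -
  have psd: "0 \<le> S g \<bullet> g" for g
    using Sig_psd[of g] a by (simp add: S_def inner_add_left P_eq inner_commute[of "Hs _"] adj[symmetric])
  let ?x = "solve (H (S h))"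
  have "0 \<le> S (h - Hs ?x) \<bullet> (h - Hs ?x) + \<epsilon>\<^sup>2 * ((R *v ?x) \<bullet> ?x)"
    using psd[of "h - Hs ?x"] R_psd[of ?x] by simp
  then show ?thesis unfolding posterior_complete_square by simp
qed

text \<open>Completing the square at \<open>w = H h\<close>. Then \<open>h - Hs w = h - P h\<close>
  is annihilated by \<open>P\<close>, so the inflation disappears and the bound is free of
  \<open>a\<close>.\<close>

lemma posterior_le:
  "posterior h \<bullet> h \<le> Sig (h - P h) \<bullet> (h - P h) + \<epsilon>\<^sup>2 * \<rho> * (norm (H h))\<^sup>2"
proof -
  let ?d = "H h - solve (H (S h))"
  have "0 \<le> (innovation *v ?d) \<bullet> ?d"
    using innovation_coercive[of ?d] a by (meson less_imp_le mult_nonneg_nonneg order_trans zero_le_power2)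
  then have "posterior h \<bullet> h \<le> S (h - P h) \<bullet> (h - P h) + \<epsilon>\<^sup>2 * ((R *v H h) \<bullet> H h)"
    using posterior_complete_square[of h "H h"] by (simp add: P_eq)
  also have "S (h - P h) = Sig (h - P h)" by (simp add: S_def P_simps) (simp add: P_eq H_Hs)
  also have "(R *v H h) \<bullet> H h \<le> \<rho> * (norm (H h))\<^sup>2"
  proof -
    have "(R *v H h) \<bullet> H h \<le> norm (R *v H h) * norm (H h)" by (rule norm_cauchy_schwarz)
    also have "\<dots> \<le> (\<rho> * norm (H h)) * norm (H h)" by (intro mult_right_mono R_bound) simp
    finally show ?thesis by (simp add: power2_eq_square)
  qed
  finally show ?thesis by (simp add: mult.assoc mult_left_mono)
qed

end

section \<open>The prediction step\<close>

context filter_setting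
begin

definition mean :: "'a measure \<Rightarrow> 'a" where "mean N = (\<integral>u. f u \<partial>N)"

definition cov :: "'a measure \<Rightarrow> 'a \<Rightarrow> 'a" where
  "cov N h = (\<integral>u. ((f u - mean N) \<bullet> h) *\<^sub>R (f u - mean N) \<partial>N)"

end

locale prediction = filter_setting +
  fixes N :: "'a measure"
  assumes prob: "prob_space N" and sets_N [measurable_cong]: "sets N = sets borel"
begin

sublocale N: prob_space N by (rule prob)

lemma integrable_bounded:
  fixes g :: "'a \<Rightarrow> 'c::{real_normed_vector, complete_space, second_countable_topology}"
  assumes "g \<in> borel_measurable borel" "\<And>u. norm (g u) \<le> c"
  shows "integrable N g"
  using assms N.finite_measure_axioms by (intro integrable_bounded_complete_space[where b=c]) simp_all

lemma norm_integral_le: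
  fixes g :: "'a \<Rightarrow> 'c::{real_normed_vector, complete_space, second_countable_topology}"
  assumes g: "g \<in> borel_measurable borel" "\<And>u. norm (g u) \<le> c"
  shows "norm (integral\<^sup>L N g) \<le> c"
proof -
  have c: "0 \<le> c" using norm_ge_zero g(2) order_trans by blast
  have "ennreal (norm (integral\<^sup>L N g)) \<le> (\<integral>\<^sup>+u. ennreal (norm (g u)) \<partial>N)"
    by (rule integral_norm_bound_ennreal[OF integrable_bounded[OF g]])
  also have "\<dots> \<le> (\<integral>\<^sup>+u. ennreal c \<partial>N)" using g by (intro nn_integral_mono ennreal_leI)
  also have "\<dots> = ennreal c" by (simp add: N.emeasure_space_1)
  finally show ?thesis using c by simp
qed

lemma integral_diff_const:
  fixes g :: "'a \<Rightarrow> 'c::{real_normed_vector, complete_space, second_countable_topology}"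
  assumes "integrable N g"
  shows "integrable N (\<lambda>u. g u - c)" and "(\<integral>u. g u - c \<partial>N) = integral\<^sup>L N g - c"
proof -
  have c: "integrable N (\<lambda>_. c)" by (rule integrable_bounded[of _ "norm c"]) auto
  show "integrable N (\<lambda>u. g u - c)" using assms c by (rule Bochner_Integration.integrable_diff)
  show "(\<integral>u. g u - c \<partial>N) = integral\<^sup>L N g - c"
    using Bochner_Integration.integral_diff[OF assms c] integral_scaleR_left[of c N "\<lambda>_. 1::real"]
    by (simp add: N.prob_space)
qed

lemma integrable_f: "integrable N f"
  by (rule integrable_bounded[OF f_measurable norm_f_le])

lemma norm_mean_le: "norm (mean N) \<le> r"
  unfolding mean_def by (rule norm_integral_le[OF f_measurable norm_f_le])

definition dev :: "'a \<Rightarrow> 'a" where "dev u = f u - mean N"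

lemma dev_measurable [measurable]: "dev \<in> borel_measurable borel"
  unfolding dev_def by measurable

lemma norm_dev_le: "norm (dev u) \<le> 2 * r"
  using norm_triangle_ineq4[of "f u" "mean N"] norm_f_le[of u] norm_mean_le by (simp add: dev_def)

lemma norm_dev_rank_one_le: "norm ((dev u \<bullet> h) *\<^sub>R dev u) \<le> 4 * r\<^sup>2 * norm h"
proof -
  have "norm ((dev u \<bullet> h) *\<^sub>R dev u) \<le> (norm (dev u) * norm h) * norm (dev u)"
    using Cauchy_Schwarz_ineq2[of "dev u" h] by (simp add: mult_right_mono)
  also have "\<dots> = (norm (dev u))\<^sup>2 * norm h" by (simp add: power2_eq_square)
  also have "\<dots> \<le> (2 * r)\<^sup>2 * norm h" using norm_dev_le by (intro mult_right_mono power_mono) auto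
  finally show ?thesis by (simp add: power_mult_distrib)
qed

lemma integrable_dev_rank_one: "integrable N (\<lambda>u. (dev u \<bullet> h) *\<^sub>R dev u)"
  by (rule integrable_bounded[OF _ norm_dev_rank_one_le]) measurable

lemma cov_eq: "cov N h = (\<integral>u. (dev u \<bullet> h) *\<^sub>R dev u \<partial>N)"
  by (simp add: cov_def dev_def)

lemma cov_inner: "cov N h \<bullet> k = (\<integral>u. (dev u \<bullet> h) * (dev u \<bullet> k) \<partial>N)"
  using integral_inner_left[OF integrable_dev_rank_one[of h], of k] by (simp add: cov_eq)

lemma norm_cov_le: "norm (cov N h) \<le> 4 * r\<^sup>2 * norm h"
  unfolding cov_eq by (rule norm_integral_le[OF _ norm_dev_rank_one_le]) measurable

lemma linear_cov: "linear (cov N)"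
proof (rule linearI)
  fix x y show "cov N (x + y) = cov N x + cov N y"
    using Bochner_Integration.integral_add[OF integrable_dev_rank_one[of x] integrable_dev_rank_one[of y]]
    by (simp add: cov_eq inner_add_right scaleR_add_left)
next
  fix c x show "cov N (c *\<^sub>R x) = c *\<^sub>R cov N x"
    using integral_scaleR_right[of N c "\<lambda>u. (dev u \<bullet> x) *\<^sub>R dev u"] by (simp add: cov_eq)
qed

lemma cov_sym: "cov N x \<bullet> y = x \<bullet> cov N y"
  by (simp add: cov_inner inner_commute[of x]) (simp add: mult.commute)

lemma cov_psd: "0 \<le> cov N h \<bullet> h"
  by (simp add: cov_inner)

lemma ennreal_cov_inner: "ennreal (cov N h \<bullet> h) = (\<integral>\<^sup>+u. ennreal ((dev u \<bullet> h)\<^sup>2) \<partial>N)"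
proof -
  have "integrable N (\<lambda>u. ((dev u \<bullet> h) *\<^sub>R dev u) \<bullet> h)"
    using integrable_dev_rank_one[of h] by (rule integrable_inner_left)
  then have "integrable N (\<lambda>u. (dev u \<bullet> h)\<^sup>2)" by (simp add: power2_eq_square)
  then show ?thesis by (simp add: cov_inner nn_integral_eq_integral power2_eq_square)
qed

lemma V_measurable: "V \<in> borel_measurable borel"
  using bounded_linear.continuous_on[OF bounded_linear_lift continuous_on_id]
  by (intro borel_measurable_continuous_onI) (simp add: norm_lift[abs_def, symmetric] continuous_on_norm)

text \<open>The variance around the mean is at most the second moment around \<open>f m\<close>.\<close>
lemma compl_dev_le:
  shows "(\<integral>\<^sup>+u. ennreal ((norm (dev u - P (dev u)))\<^sup>2) \<partial>N) \<le> ennreal \<alpha> * (\<integral>\<^sup>+u. ennreal ((V (u - m))\<^sup>2) \<partial>N)"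
    and "(\<integral>\<^sup>+u. ennreal ((norm (dev u - P (dev u)))\<^sup>2) \<partial>N) \<le> ennreal (4 * r\<^sup>2)"
proof -
  let ?q = "\<lambda>u. dev u - P (dev u)"
  define d where "d = (mean N - f m) - P (mean N - f m)"
  have P_meas: "P \<in> borel_measurable borel"
    using bounded_linear.continuous_on[OF bounded_linear_compose[OF _ bounded_linear_H] continuous_on_id, of Hs]
      linear_Hs by (intro borel_measurable_continuous_onI) (simp add: P_eq[abs_def] linear_conv_bounded_linear)
  note [measurable] = measurable_compose[OF _ P_meas]
  have q[measurable]: "?q \<in> borel_measurable borel" by measurable
  have qb: "norm (?q u) \<le> 2 * r" for u using norm_compl_le norm_dev_le order_trans by blast
  have q2b: "norm ((norm (?q u))\<^sup>2) \<le> (2 * r)\<^sup>2" for u using power_mono[OF qb norm_ge_zero, of u 2] by simp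
  have int2: "integrable N (\<lambda>u. (norm (?q u))\<^sup>2)" by (rule integrable_bounded[OF _ q2b]) measurable
  have intq: "integrable N ?q" by (rule integrable_bounded[OF q qb])
  have "(\<integral>u. dev u \<partial>N) = 0"
    using integral_diff_const(2)[OF integrable_f, of "mean N"] by (simp add: dev_def mean_def[symmetric])
  then have q0: "(\<integral>u. ?q u \<partial>N) = 0"
    using integral_bounded_linear[OF bounded_linear_compl integrable_bounded[OF dev_measurable norm_dev_le]]
    by (simp add: P_simps)
  \<comment> \<open>Bias-variance decomposition with constant bias \<open>d\<close>; the cross term
    integrates to zero by \<open>q0\<close>.\<close>
  have sq: "(norm ((f u - f m) - P (f u - f m)))\<^sup>2 = (norm (?q u))\<^sup>2 + (2 * (?q u \<bullet> d) + (norm d)\<^sup>2)" for u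
  proof -
    have "(f u - f m) - P (f u - f m) = ?q u + d" by (simp add: dev_def d_def P_simps)
    then show ?thesis by (simp add: power2_norm_eq_inner inner_add_left inner_add_right inner_commute)
  qed
  have intd: "integrable N (\<lambda>u. 2 * (?q u \<bullet> d) + (norm d)\<^sup>2)"
    using intq by (intro Bochner_Integration.integrable_add integrable_mult_right integrable_inner_left) auto
  have "(\<integral>u. 2 * (?q u \<bullet> d) + (norm d)\<^sup>2 \<partial>N) = (norm d)\<^sup>2"
    using intq q0 by (simp add: integral_inner_left N.prob_space)
  then have "(\<integral>u. (norm (?q u))\<^sup>2 \<partial>N) \<le> (\<integral>u. (norm ((f u - f m) - P (f u - f m)))\<^sup>2 \<partial>N)"
    unfolding sq using Bochner_Integration.integral_add[OF int2 intd] by simp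
  moreover have "integrable N (\<lambda>u. (norm ((f u - f m) - P (f u - f m)))\<^sup>2)"
    unfolding sq using int2 intd by (rule Bochner_Integration.integrable_add)
  ultimately have "(\<integral>\<^sup>+u. ennreal ((norm (?q u))\<^sup>2) \<partial>N) \<le> (\<integral>\<^sup>+u. ennreal ((norm ((f u - f m) - P (f u - f m)))\<^sup>2) \<partial>N)"
    using int2 by (simp add: nn_integral_eq_integral ennreal_leI)
  also have "\<dots> \<le> (\<integral>\<^sup>+u. ennreal \<alpha> * ennreal ((V (u - m))\<^sup>2) \<partial>N)"
  proof (rule nn_integral_mono)
    fix u
    have "(norm ((f u - f m) - P (f u - f m)))\<^sup>2 \<le> (sqrt \<alpha> * V (u - m))\<^sup>2"
      using f_squeeze by (rule power_mono) simp
    then show "ennreal ((norm ((f u - f m) - P (f u - f m)))\<^sup>2) \<le> ennreal \<alpha> * ennreal ((V (u - m))\<^sup>2)"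
      using alpha by (simp add: power_mult_distrib ennreal_mult'[symmetric] ennreal_leI)
  qed
  also have "\<dots> = ennreal \<alpha> * (\<integral>\<^sup>+u. ennreal ((V (u - m))\<^sup>2) \<partial>N)"
  proof (rule nn_integral_cmult)
    note [measurable] = measurable_compose[OF _ V_measurable]
    show "(\<lambda>u. ennreal ((V (u - m))\<^sup>2)) \<in> borel_measurable N" by measurable
  qed
  finally show "(\<integral>\<^sup>+u. ennreal ((norm (dev u - P (dev u)))\<^sup>2) \<partial>N) \<le> ennreal \<alpha> * (\<integral>\<^sup>+u. ennreal ((V (u - m))\<^sup>2) \<partial>N)" .
  have "(\<integral>\<^sup>+u. ennreal ((norm (?q u))\<^sup>2) \<partial>N) \<le> (\<integral>\<^sup>+u. ennreal (4 * r\<^sup>2) \<partial>N)"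
    using q2b by (intro nn_integral_mono ennreal_leI) (simp add: power_mult_distrib)
  then show "(\<integral>\<^sup>+u. ennreal ((norm (dev u - P (dev u)))\<^sup>2) \<partial>N) \<le> ennreal (4 * r\<^sup>2)"
    by (simp add: N.emeasure_space_1)
qed

text \<open>First moment from second by Young's inequality with weight \<open>s\<close>, which gives
  \<open>s / 2\<close> twice.\<close>

lemma nn_integral_V_le:
  assumes s: "0 < s" "(\<integral>\<^sup>+u. ennreal ((V (u - m))\<^sup>2) \<partial>N) \<le> ennreal (s\<^sup>2)"
  shows "(\<integral>\<^sup>+u. ennreal (V (u - m)) \<partial>N) \<le> ennreal s"
proof -
  note [measurable] = measurable_compose[OF _ V_measurable]
  have "(\<integral>\<^sup>+u. ennreal (V (u - m)) \<partial>N) \<le> (\<integral>\<^sup>+u. ennreal (1 / (2 * s)) * ennreal ((V (u - m))\<^sup>2) + ennreal (s / 2) \<partial>N)"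
  proof (rule nn_integral_mono)
    fix u
    have "0 \<le> (V (u - m) - s)\<^sup>2" by simp
    then have "2 * s * V (u - m) \<le> (V (u - m))\<^sup>2 + s\<^sup>2" by (simp add: power2_eq_square algebra_simps)
    then have "V (u - m) \<le> 1 / (2 * s) * (V (u - m))\<^sup>2 + s / 2"
      using s by (simp add: field_simps power2_eq_square)
    then show "ennreal (V (u - m)) \<le> ennreal (1 / (2 * s)) * ennreal ((V (u - m))\<^sup>2) + ennreal (s / 2)"
      using s by (simp add: ennreal_mult'[symmetric] ennreal_plus[symmetric] ennreal_leI del: ennreal_plus)
  qed
  also have "\<dots> = ennreal (1 / (2 * s)) * (\<integral>\<^sup>+u. ennreal ((V (u - m))\<^sup>2) \<partial>N) + ennreal (s / 2)"
    by (subst nn_integral_add) (auto simp: nn_integral_cmult N.emeasure_space_1)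
  also have "\<dots> \<le> ennreal (1 / (2 * s)) * ennreal (s\<^sup>2) + ennreal (s / 2)"
    using s by (intro add_right_mono mult_left_mono) auto
  also have "\<dots> = ennreal s"
    using s by (simp add: ennreal_mult'[symmetric] ennreal_plus[symmetric] power2_eq_square del: ennreal_plus)
  finally show ?thesis .
qed

text \<open>Splitting \<open>w - u\<close> at the previous mean \<open>m\<close> separates the
  spread of the law from the previous error. The map \<open>A\<close> is later the complementary
  projection with \<open>q = sqrt \<alpha>\<close> and \<open>lift\<close> with
  \<open>q = sqrt L\<close>.\<close>

lemma mean_error_le:
  fixes A :: "'a \<Rightarrow> 'c::{real_normed_vector, second_countable_topology}"
  assumes A: "bounded_linear A" and q: "0 \<le> q" "\<And>w. norm (A (f w - f u)) \<le> q * V (w - u)"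
    and s: "0 < s" "(\<integral>\<^sup>+w. ennreal ((V (w - m))\<^sup>2) \<partial>N) \<le> ennreal (s\<^sup>2)"
  shows "norm (A (mean N - f u)) \<le> q * (V (m - u) + s)"
proof -
  note [measurable] = measurable_compose[OF _ V_measurable]
  note int = integral_diff_const(1)[OF integrable_f, of "f u"]
  have "mean N - f u = (\<integral>w. f w - f u \<partial>N)"
    using integral_diff_const(2)[OF integrable_f, of "f u"] by (simp add: mean_def)
  then have "A (mean N - f u) = (\<integral>w. A (f w - f u) \<partial>N)"
    using integral_bounded_linear[OF A int] by simp
  then have "ennreal (norm (A (mean N - f u))) \<le> (\<integral>\<^sup>+w. ennreal (norm (A (f w - f u))) \<partial>N)"
    using integral_norm_bound_ennreal[OF integrable_bounded_linear[OF A int]] by simp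
  also have "\<dots> \<le> (\<integral>\<^sup>+w. ennreal q * ennreal (V (w - m)) + ennreal (q * V (m - u)) \<partial>N)"
  proof (rule nn_integral_mono)
    fix w
    have "norm (A (f w - f u)) \<le> q * (V (w - m) + V (m - u))"
      using q(2)[of w] mult_left_mono[OF V_add[of "w - m" "m - u"] q(1)] by simp
    then show "ennreal (norm (A (f w - f u))) \<le> ennreal q * ennreal (V (w - m)) + ennreal (q * V (m - u))"
      using q(1) by (simp add: ennreal_mult'[symmetric] ennreal_plus[symmetric] ennreal_leI distrib_left del: ennreal_plus)
  qed
  also have "\<dots> = ennreal q * (\<integral>\<^sup>+w. ennreal (V (w - m)) \<partial>N) + ennreal (q * V (m - u))"
    by (subst nn_integral_add) (auto simp: nn_integral_cmult N.emeasure_space_1)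
  also have "\<dots> \<le> ennreal q * ennreal s + ennreal (q * V (m - u))"
    by (intro add_right_mono mult_left_mono nn_integral_V_le s) simp
  also have "\<dots> = ennreal (q * (V (m - u) + s))"
    using q(1) s(1) by (simp add: ennreal_mult'[symmetric] ennreal_plus[symmetric] algebra_simps del: ennreal_plus)
  finally show ?thesis using q(1) s(1) by (simp add: ennreal_le_iff)
qed

end

section \<open>One step of the filter\<close>

locale gpf_analysis = filter_setting H Hs \<beta> \<Psi> r L \<alpha>
  for H :: "'h::{real_inner, polish_space} \<Rightarrow> real^'k" and Hs :: "real^'k \<Rightarrow> 'h" and \<beta> \<Psi> r L \<alpha> +
  fixes R :: "real^'k^'k" and a \<rho> :: real and e :: "nat \<Rightarrow> 'h"
  assumes a: "0 < a"
    and R_sym: "(R *v p) \<bullet> q = p \<bullet> (R *v q)" and R_psd: "0 \<le> (R *v p) \<bullet> p"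
    and R_bound: "norm (R *v p) \<le> \<rho> * norm p" and rho: "0 \<le> \<rho>"
    and e: "(\<lambda>n. (h \<bullet> e n)\<^sup>2) sums (norm h)\<^sup>2"
begin

abbreviation basis :: "'k \<Rightarrow> 'h" where "basis k \<equiv> Hs (axis k 1)"

text \<open>The trace of \<open>C\<close> plus \<beta> times the trace of its observed block: for a
  Gaussian law, the mean squared V-distance to the mean. Extended values allow an initial covariance
  whose trace is not known to be finite.\<close>

definition trV :: "('h \<Rightarrow> 'h) \<Rightarrow> ennreal" where
  "trV C = (\<Sum>n. ennreal (C (e n) \<bullet> e n)) + ennreal \<beta> * (\<Sum>k\<in>UNIV. ennreal (C (basis k) \<bullet> basis k))"

lemma norm_H_square: "(norm (H w))\<^sup>2 = (\<Sum>k\<in>UNIV. (w \<bullet> basis k)\<^sup>2)"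
proof -
  have "H w $ k = w \<bullet> basis k" for k using adj[of w "axis k 1"] by (simp add: inner_axis)
  then show ?thesis by (simp add: power2_norm_eq_inner inner_vec_def) (simp add: power2_eq_square)
qed

lemma nn_integral_V_square:
  assumes G: "gaussian_measure m C N"
  shows "(\<integral>\<^sup>+u. ennreal ((V (u - m))\<^sup>2) \<partial>N) = trV C"
proof -
  have [measurable_cong]: "sets N = sets borel" using G by (simp add: gaussian_measure_def)
  have "(\<integral>\<^sup>+u. ennreal ((V (u - m))\<^sup>2) \<partial>N)
      = (\<integral>\<^sup>+u. ennreal ((norm (u - m))\<^sup>2) + ennreal \<beta> * (\<Sum>k\<in>UNIV. ennreal (((u - m) \<bullet> basis k)\<^sup>2)) \<partial>N)"
    using beta by (intro nn_integral_cong)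
      (simp add: V_square norm_H_square ennreal_mult'[symmetric] sum_nonneg)
  also have "\<dots> = (\<integral>\<^sup>+u. ennreal ((norm (u - m))\<^sup>2) \<partial>N)
       + ennreal \<beta> * (\<Sum>k\<in>UNIV. \<integral>\<^sup>+u. ennreal (((u - m) \<bullet> basis k)\<^sup>2) \<partial>N)"
    by (subst nn_integral_add) (simp_all add: nn_integral_cmult nn_integral_sum del: sum_ennreal)
  also have "(\<integral>\<^sup>+u. ennreal ((norm (u - m))\<^sup>2) \<partial>N) = (\<Sum>n. \<integral>\<^sup>+u. ennreal (((u - m) \<bullet> e n)\<^sup>2) \<partial>N)"
    by (rule nn_integral_norm_square_parseval[OF e]) measurable
  finally show ?thesis by (simp only: gaussian_measure_second_moment[OF G] trV_def)
qed

text \<open>The trace of \<open>P\<close> is its rank; exchange the sums and apply Parseval to each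
  \<open>basis k\<close>. It gives the noise floor a finite trace.\<close>

lemma suminf_norm_H_square: "(\<Sum>n. ennreal ((norm (H (e n)))\<^sup>2)) = ennreal (real CARD('k))"
proof -
  have "(\<Sum>n. ennreal ((norm (H (e n)))\<^sup>2)) = (\<Sum>n. \<Sum>k\<in>UNIV. ennreal ((basis k \<bullet> e n)\<^sup>2))"
    by (simp add: norm_H_square inner_commute)
  also have "\<dots> = (\<Sum>k\<in>UNIV. \<Sum>n. ennreal ((basis k \<bullet> e n)\<^sup>2))"
    by (rule suminf_sum) simp
  also have "\<dots> = (\<Sum>k::'k\<in>UNIV. ennreal ((norm (basis k))\<^sup>2))"
    by (intro sum.cong refl suminf_ennreal_eq[OF _ e]) simp
  also have "\<dots> = ennreal (real CARD('k))" by (simp add: ennreal_of_nat_eq_real_of_nat)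
  finally show ?thesis .
qed

definition noise_const :: real where "noise_const = (1 + \<beta>) * (\<rho> * real CARD('k))"

lemma noise_const_nonneg: "0 \<le> noise_const"
  using beta rho by (simp add: noise_const_def)

definition gain_const :: real where "gain_const = sqrt (1 + \<beta>) * (4 * r\<^sup>2 / a + 1)"

text \<open>The residual factor with \<open>b = 4 * r\<^sup>2\<close>, applied to an observed error
  of size at most \<open>2 * r\<close> and measured in V.\<close>

definition residual_const :: real where "residual_const = sqrt (1 + \<beta>) * (\<rho> / a + 4 * r\<^sup>2 / a + 2) * (2 * r)"

text \<open>The first summand is squeezing of the unobserved error; the second is observed error,
  amplified by at most \<open>sqrt L\<close>, leaking through the gain into unobserved
  directions.\<close>

definition contraction :: real where "contraction = sqrt \<alpha> + 4 * r\<^sup>2 / a * sqrt L"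

lemma gain_const_nonneg: "0 \<le> gain_const" and residual_const_nonneg: "0 \<le> residual_const"
  and contraction_nonneg: "0 \<le> contraction"
  using beta a rho r L alpha by (simp_all add: gain_const_def residual_const_def contraction_def)

abbreviation step :: "real \<Rightarrow> 'h \<times> ('h \<Rightarrow> 'h) \<Rightarrow> real^'k \<Rightarrow> 'h \<times> ('h \<Rightarrow> 'h)" where
  "step \<epsilon> \<equiv> gpf_step \<Psi> r \<beta> H Hs \<epsilon> R (\<lambda>h. a *\<^sub>R P h)"

end

locale gpf_step_analysis = gpf_analysis H Hs \<beta> \<Psi> r L \<alpha> R a \<rho> e
  for H :: "'h::{real_inner, polish_space} \<Rightarrow> real^'k" and Hs :: "real^'k \<Rightarrow> 'h" and \<beta> \<Psi> r L \<alpha> R a \<rho> e +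
  fixes \<epsilon> :: real and m :: 'h and C :: "'h \<Rightarrow> 'h" and N :: "'h measure"
  assumes eps: "0 < \<epsilon>" and gaussian: "gaussian_measure m C N"
begin

sublocale prediction H Hs \<beta> \<Psi> r L \<alpha> N
  using gaussian by (intro prediction.intro prediction_axioms.intro filter_setting_axioms) (simp_all add: gaussian_measure_def)

sublocale K: kalman_update H Hs "cov N" R a \<epsilon> "4 * r\<^sup>2" \<rho>
  by (intro kalman_update.intro kalman_update_axioms.intro observation_axioms
      a eps linear_cov cov_sym cov_psd norm_cov_le R_sym R_psd R_bound rho) simp

lemma step_eq: "step \<epsilon> (m, C) y = (mean N + K.gain (y - H (mean N)), K.posterior)"
proof -
  have f: "(\<lambda>u. \<Psi> (projBV r \<beta> H Hs u)) = f" by (simp add: f_def fun_eq_iff)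
  have S: "(\<integral>u. ((f u - mean N) \<bullet> h) *\<^sub>R (f u - mean N) \<partial>N) + a *\<^sub>R P h = K.S h" for h
    by (simp add: K.S_def cov_def)
  have "kgain H Hs \<epsilon> R K.S = K.gain"
    using K.kgain_eq by (simp add: K.S_def[abs_def])
  then show ?thesis
    by (simp add: gpf_step_def Let_def gauss_eq[OF gaussian] f mean_def[symmetric] S K.posterior_def[abs_def])
qed

lemma trV_posterior_le:
  "trV K.posterior \<le> (\<integral>\<^sup>+u. ennreal ((norm (dev u - P (dev u)))\<^sup>2) \<partial>N) + ennreal (\<epsilon>\<^sup>2 * noise_const)"
proof -
  have le: "ennreal (K.posterior h \<bullet> h)
      \<le> ennreal (cov N (h - P h) \<bullet> (h - P h)) + ennreal (\<epsilon>\<^sup>2 * \<rho>) * ennreal ((norm (H h))\<^sup>2)" for h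
    using K.posterior_le[of h] cov_psd[of "h - P h"] rho
    by (simp add: ennreal_mult'[symmetric] ennreal_plus[symmetric] ennreal_leI del: ennreal_plus)
  have "(\<Sum>n. ennreal (K.posterior (e n) \<bullet> e n))
     \<le> (\<Sum>n. ennreal (cov N (e n - P (e n)) \<bullet> (e n - P (e n))) + ennreal (\<epsilon>\<^sup>2 * \<rho>) * ennreal ((norm (H (e n)))\<^sup>2))"
    by (intro suminf_le le) auto
  also have "\<dots> = (\<Sum>n. ennreal (cov N (e n - P (e n)) \<bullet> (e n - P (e n))))
     + ennreal (\<epsilon>\<^sup>2 * \<rho>) * (\<Sum>n. ennreal ((norm (H (e n)))\<^sup>2))"
    by (subst suminf_add[symmetric]) auto
  also have "(\<Sum>n. ennreal (cov N (e n - P (e n)) \<bullet> (e n - P (e n))))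
      = (\<Sum>n. \<integral>\<^sup>+u. ennreal (((dev u - P (dev u)) \<bullet> e n)\<^sup>2) \<partial>N)"
    by (simp only: ennreal_cov_inner compl_sym)
  also have "\<dots> = (\<integral>\<^sup>+u. ennreal ((norm (dev u - P (dev u)))\<^sup>2) \<partial>N)"
    by (rule nn_integral_norm_square_parseval[OF e, symmetric])
       (use measurable_compose[OF dev_measurable borel_measurable_continuous_onI[OF
          bounded_linear.continuous_on[OF bounded_linear_compl continuous_on_id]]] in simp)
  finally have 1: "(\<Sum>n. ennreal (K.posterior (e n) \<bullet> e n))
     \<le> (\<integral>\<^sup>+u. ennreal ((norm (dev u - P (dev u)))\<^sup>2) \<partial>N) + ennreal (\<epsilon>\<^sup>2 * \<rho>) * ennreal (real CARD('k))"
    by (simp only: suminf_norm_H_square)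
  \<comment> \<open>\<open>basis k\<close> lies in the range of \<open>P\<close>, so the covariance
    term drops out: the \<beta>-part adds noise only and leaves the factor \<alpha> of the trace
    recursion intact.\<close>
  have "ennreal (K.posterior (basis k) \<bullet> basis k) \<le> ennreal (\<epsilon>\<^sup>2 * \<rho>)" for k
    using K.posterior_le[of "basis k"] by (intro ennreal_leI) (simp add: H_Hs)
  then have "(\<Sum>k\<in>UNIV. ennreal (K.posterior (basis k) \<bullet> basis k)) \<le> (\<Sum>k::'k\<in>UNIV. ennreal (\<epsilon>\<^sup>2 * \<rho>))"
    by (intro sum_mono)
  also have "\<dots> = ennreal (\<epsilon>\<^sup>2 * \<rho>) * ennreal (real CARD('k))"
    by (simp add: ennreal_of_nat_eq_real_of_nat mult.commute)
  finally have 2: "ennreal \<beta> * (\<Sum>k\<in>UNIV. ennreal (K.posterior (basis k) \<bullet> basis k))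
      \<le> ennreal \<beta> * (ennreal (\<epsilon>\<^sup>2 * \<rho>) * ennreal (real CARD('k)))"
    by (rule mult_left_mono) simp
  have "ennreal (\<epsilon>\<^sup>2 * \<rho>) * ennreal (real CARD('k)) + ennreal \<beta> * (ennreal (\<epsilon>\<^sup>2 * \<rho>) * ennreal (real CARD('k)))
      = ennreal (\<epsilon>\<^sup>2 * noise_const)"
    using rho beta
    by (simp add: ennreal_mult'[symmetric] ennreal_mult[symmetric] ennreal_plus[symmetric] noise_const_def algebra_simps del: ennreal_plus)
  then show ?thesis using add_mono[OF 1 2] by (simp add: trV_def add.assoc)
qed

text \<open>Free of \<open>C\<close>, since \<open>f\<close> is bounded: one step suffices to enter
  the regime of finite traces.\<close>

lemma trV_step_bounded: "trV (snd (step \<epsilon> (m, C) y)) \<le> ennreal (4 * r\<^sup>2 + \<epsilon>\<^sup>2 * noise_const)"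
proof -
  have "trV K.posterior \<le> ennreal (4 * r\<^sup>2) + ennreal (\<epsilon>\<^sup>2 * noise_const)"
    using add_right_mono[OF compl_dev_le(2)] trV_posterior_le order_trans by blast
  then show ?thesis using noise_const_nonneg by (simp add: step_eq)
qed

lemma trV_step_contracts: "trV (snd (step \<epsilon> (m, C) y)) \<le> ennreal \<alpha> * trV C + ennreal (\<epsilon>\<^sup>2 * noise_const)"
proof -
  have "trV K.posterior \<le> ennreal \<alpha> * trV C + ennreal (\<epsilon>\<^sup>2 * noise_const)"
    using add_right_mono[OF compl_dev_le(1)[of m]] trV_posterior_le order_trans
    unfolding nn_integral_V_square[OF gaussian] by blast
  then show ?thesis by (simp add: step_eq)
qed

text \<open>Keeps the recursion meaningful: the posterior is again a trace class covariance, so the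
  next \<open>gauss\<close> denotes a Gaussian law.\<close>

lemma step_gaussian: "\<exists>N'. gaussian_measure (fst (step \<epsilon> (m, C) y)) (snd (step \<epsilon> (m, C) y)) N'"
proof -
  have "\<exists>N'. gaussian_measure m' K.posterior N'" for m'
  proof (rule gaussian_measure_exists[OF K.linear_posterior K.posterior_sym K.posterior_psd _ e])
    show "K.posterior h \<bullet> h \<le> (4 * r\<^sup>2 + \<epsilon>\<^sup>2 * \<rho>) * (norm h)\<^sup>2" for h
    proof -
      have "cov N (h - P h) \<bullet> (h - P h) \<le> norm (cov N (h - P h)) * norm (h - P h)" by (rule norm_cauchy_schwarz)
      also have "\<dots> \<le> (4 * r\<^sup>2 * norm (h - P h)) * norm (h - P h)" by (intro mult_right_mono norm_cov_le) simp
      also have "\<dots> = 4 * r\<^sup>2 * (norm (h - P h))\<^sup>2" by (simp add: power2_eq_square)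
      also have "\<dots> \<le> 4 * r\<^sup>2 * (norm h)\<^sup>2" by (intro mult_left_mono power_mono norm_compl_le) auto
      moreover have "\<epsilon>\<^sup>2 * \<rho> * (norm (H h))\<^sup>2 \<le> \<epsilon>\<^sup>2 * \<rho> * (norm h)\<^sup>2"
        using rho by (intro mult_left_mono power_mono norm_H_le) auto
      ultimately show ?thesis using K.posterior_le[of h] by (simp add: distrib_right)
    qed
    have "(\<Sum>n. ennreal (K.posterior (e n) \<bullet> e n)) \<le> ennreal (4 * r\<^sup>2 + \<epsilon>\<^sup>2 * noise_const)"
    proof -
      have "(\<Sum>n. ennreal (K.posterior (e n) \<bullet> e n)) \<le> trV K.posterior" by (simp add: trV_def)
      then show ?thesis using trV_step_bounded by (simp add: step_eq)
    qed
    then have "(\<Sum>n. ennreal (K.posterior (e n) \<bullet> e n)) \<noteq> top" by (metis ennreal_less_top leD)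
    then show "summable (\<lambda>n. K.posterior (e n) \<bullet> e n)"
      using K.posterior_psd by (intro summable_suminf_not_top) auto
  qed
  then show ?thesis by (simp add: step_eq)
qed

lemma V_gain_le: "V (K.gain z) \<le> gain_const * norm z"
proof -
  have "V (K.gain z) \<le> sqrt (1 + \<beta>) * norm (K.gain z)" by (rule V_le)
  also have "\<dots> \<le> sqrt (1 + \<beta>) * ((4 * r\<^sup>2 / a + 1) * norm z)"
    using beta by (intro mult_left_mono K.norm_gain_le) auto
  finally show ?thesis by (simp add: gain_const_def)
qed

context
  fixes u :: 'h and \<eta> :: "real^'k"
  assumes u: "u \<in> cball 0 r"
begin

text \<open>With the true state in the ball, \<open>f u = \<Psi> u\<close>, and the data enter only
  through the true observation and the noise. The error is therefore the prediction error reduced by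
  the gain, plus filtered noise.\<close>

lemma step_error_eq:
  "fst (step \<epsilon> (m, C) (H (\<Psi> u) + \<epsilon> *\<^sub>R \<eta>)) - \<Psi> u
     = ((mean N - f u) - K.gain (H (mean N - f u))) + \<epsilon> *\<^sub>R K.gain \<eta>"
proof -
  have "H (\<Psi> u) + \<epsilon> *\<^sub>R \<eta> - H (mean N) = \<epsilon> *\<^sub>R \<eta> + (-1) *\<^sub>R H (mean N - f u)"
    using f_eq[OF u] by (simp add: H_simps)
  then have "K.gain (H (\<Psi> u) + \<epsilon> *\<^sub>R \<eta> - H (mean N)) = \<epsilon> *\<^sub>R K.gain \<eta> - K.gain (H (mean N - f u))"
    by (simp only: K.gain_simps) simp
  then show ?thesis using f_eq[OF u] by (simp add: step_eq)
qed

lemma norm_H_mean_error_le: "norm (mean N - f u) \<le> 2 * r" "norm (H (mean N - f u)) \<le> 2 * r"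
proof -
  show "norm (mean N - f u) \<le> 2 * r"
    using norm_triangle_ineq4[of "mean N" "f u"] norm_mean_le norm_f_le[of u] by simp
  then show "norm (H (mean N - f u)) \<le> 2 * r" using norm_H_le order_trans by blast
qed

lemma V_step_error_le:
  "V (fst (step \<epsilon> (m, C) (H (\<Psi> u) + \<epsilon> *\<^sub>R \<eta>)) - \<Psi> u)
     \<le> V ((mean N - f u) - K.gain (H (mean N - f u))) + \<epsilon> * (gain_const * norm \<eta>)"
proof -
  have "V (\<epsilon> *\<^sub>R K.gain \<eta>) \<le> \<epsilon> * (gain_const * norm \<eta>)"
    using V_gain_le eps by (simp add: V_scale mult_left_mono)
  then show ?thesis unfolding step_error_eq by (rule order_trans[OF V_add add_left_mono])
qed

text \<open>Involves neither the previous error nor \<open>C\<close>, so it can start the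
  recursion.\<close>

lemma step_error_bounded:
  "V (fst (step \<epsilon> (m, C) (H (\<Psi> u) + \<epsilon> *\<^sub>R \<eta>)) - \<Psi> u)
     \<le> (sqrt (1 + \<beta>) + gain_const) * (2 * r) + \<epsilon> * (gain_const * norm \<eta>)"
proof -
  let ?x = "mean N - f u"
  have "V (?x - K.gain (H ?x)) \<le> V ?x + V (K.gain (H ?x))"
    using V_add[of ?x "(-1) *\<^sub>R K.gain (H ?x)"] V_scale[of "-1" "K.gain (H ?x)"] by simp
  also have "\<dots> \<le> sqrt (1 + \<beta>) * norm ?x + gain_const * norm (H ?x)"
    by (intro add_mono V_le V_gain_le)
  also have "\<dots> \<le> sqrt (1 + \<beta>) * (2 * r) + gain_const * (2 * r)"
    using beta gain_const_nonneg norm_H_mean_error_le by (intro add_mono mult_left_mono) auto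
  finally show ?thesis using V_step_error_le by (simp add: distrib_right)
qed

lemma step_error_contracts:
  assumes s: "0 < s" "trV C \<le> ennreal (s\<^sup>2)"
  shows "V (fst (step \<epsilon> (m, C) (H (\<Psi> u) + \<epsilon> *\<^sub>R \<eta>)) - \<Psi> u)
     \<le> contraction * (V (m - u) + s) + \<epsilon> * (residual_const + gain_const * norm \<eta>)"
proof -
  let ?x = "mean N - f u"
  let ?T = "V (m - u) + s"
  have s': "0 < s" "(\<integral>\<^sup>+w. ennreal ((V (w - m))\<^sup>2) \<partial>N) \<le> ennreal (s\<^sup>2)"
    using s by (simp_all add: nn_integral_V_square[OF gaussian])
  have compl: "norm (?x - P ?x) \<le> sqrt \<alpha> * ?T"
    using mean_error_le[OF bounded_linear_compl _ f_squeeze s'] alpha by simp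
  \<comment> \<open>Since \<open>lift\<close> turns V into a norm, the bound for linear images
    applies to V itself.\<close>
  have "V ?x \<le> sqrt L * ?T"
    using mean_error_le[OF bounded_linear_lift _ _ s', of "sqrt L" u] L f_Lip by (simp add: norm_lift)
  then have Hx: "norm (H ?x) \<le> sqrt L * ?T" using norm_H_le_V order_trans by blast
  have "norm ((?x - K.gain (H ?x)) - P (?x - K.gain (H ?x)))
      \<le> norm (?x - P ?x) + norm (K.gain (H ?x) - P (K.gain (H ?x)))"
    using norm_triangle_ineq4[of "?x - P ?x" "K.gain (H ?x) - P (K.gain (H ?x))"]
    by (simp add: P_simps algebra_simps)
  also have "\<dots> \<le> sqrt \<alpha> * ?T + 4 * r\<^sup>2 / a * norm (H ?x)"
    by (intro add_mono compl K.norm_gain_compl_le)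
  also have "\<dots> \<le> sqrt \<alpha> * ?T + 4 * r\<^sup>2 / a * (sqrt L * ?T)"
    using a Hx by (intro add_left_mono mult_left_mono) auto
  also have "\<dots> = contraction * ?T" by (simp only: contraction_def distrib_right mult.assoc)
  finally have 1: "norm ((?x - K.gain (H ?x)) - P (?x - K.gain (H ?x))) \<le> contraction * ?T" .
  \<comment> \<open>The observed part is not compared with the previous error: the a priori bound
    \<open>2 * r\<close> is enough, because the residual already carries \<epsilon>.\<close>
  have "norm (H (?x - K.gain (H ?x))) \<le> (\<rho> / a + 4 * r\<^sup>2 / a + 2) * \<epsilon> * norm (H ?x)"
    using K.norm_residual_le[of "H ?x"] by (simp add: H_simps)
  also have "\<dots> \<le> (\<rho> / a + 4 * r\<^sup>2 / a + 2) * \<epsilon> * (2 * r)"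
    using rho a eps norm_H_mean_error_le(2) by (intro mult_left_mono) auto
  finally have 2: "sqrt (1 + \<beta>) * norm (H (?x - K.gain (H ?x)))
      \<le> sqrt (1 + \<beta>) * ((\<rho> / a + 4 * r\<^sup>2 / a + 2) * \<epsilon> * (2 * r))"
    using beta by (intro mult_left_mono) auto
  have "V (?x - K.gain (H ?x)) \<le> contraction * ?T + \<epsilon> * residual_const"
    using V_le_split[of "?x - K.gain (H ?x)"] 1 2 by (simp add: residual_const_def algebra_simps)
  then show ?thesis using V_step_error_le by (simp add: distrib_left)
qed

end

end

section \<open>Long-time accuracy\<close>

text \<open>Symmetry and positivity of R come from its representation as a second moment matrix:
  \<open>(R *v p) \<bullet> q\<close> is the expectation of the product of two scalar projections of
  the noise.\<close>

lemma noise_model_covariance: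
  fixes R :: "real^'k^'k"
  assumes noise: "noise_model M \<eta> R"
  shows "(R *v p) \<bullet> q = p \<bullet> (R *v q)" and "0 \<le> (R *v p) \<bullet> p"
proof -
  interpret prob_space M using noise by (simp add: noise_model_def)
  have nth: "(\<lambda>x::real^'k. x $ a) \<in> borel_measurable borel" for a
    by (intro borel_measurable_continuous_onI continuous_intros)
  note [measurable] = measurable_compose[OF _ nth]
  have [measurable]: "\<eta> 1 \<in> borel_measurable M" and int: "integrable M (\<lambda>\<omega>. (norm (\<eta> 1 \<omega>))\<^sup>2)"
    and R: "R $ a $ b = (\<integral>\<omega>. \<eta> 1 \<omega> $ a * \<eta> 1 \<omega> $ b \<partial>M)" for a b
    using noise by (simp_all add: noise_model_def)
  have prod: "integrable M (\<lambda>\<omega>. \<eta> 1 \<omega> $ a * \<eta> 1 \<omega> $ b)" for a b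
  proof (rule Bochner_Integration.integrable_bound[OF int])
    have "\<bar>x $ a * x $ b\<bar> \<le> (norm x)\<^sup>2" for x :: "real^'k"
      using mult_mono[OF component_le_norm_cart[of x a] component_le_norm_cart[of x b]]
      by (simp add: abs_mult power2_eq_square)
    then show "AE \<omega> in M. norm (\<eta> 1 \<omega> $ a * \<eta> 1 \<omega> $ b) \<le> norm ((norm (\<eta> 1 \<omega>))\<^sup>2)" by simp
  qed measurable
  have form: "(R *v p) \<bullet> q = (\<Sum>a\<in>UNIV. \<Sum>b\<in>UNIV. R $ a $ b * (p $ b * q $ a))" for p q
    by (simp add: inner_vec_def matrix_vector_mult_def sum_distrib_right mult.assoc)
  have eq: "(R *v p) \<bullet> q = (\<integral>\<omega>. (\<eta> 1 \<omega> \<bullet> p) * (\<eta> 1 \<omega> \<bullet> q) \<partial>M)" for p q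
  proof -
    have "(\<eta> 1 \<omega> \<bullet> p) * (\<eta> 1 \<omega> \<bullet> q)
        = (\<Sum>a\<in>UNIV. \<Sum>b\<in>UNIV. (\<eta> 1 \<omega> $ a * \<eta> 1 \<omega> $ b) * (p $ b * q $ a))" for \<omega>
      by (subst sum.swap) (simp add: inner_vec_def sum_product mult_ac)
    then show ?thesis
      using prod by (simp add: form R)
  qed
  show "(R *v p) \<bullet> q = p \<bullet> (R *v q)"
    by (subst inner_commute[of p]) (simp add: eq mult.commute)
  show "0 \<le> (R *v p) \<bullet> p" by (simp add: eq)
qed

text \<open>From \<open>norm x \<le> 1 + (norm x)\<^sup>2\<close>; the bound by the trace of R is
  uniform in \<open>j\<close>.\<close>

lemma noise_model_first_moment:
  fixes R :: "real^'k^'k"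
  assumes noise: "noise_model M \<eta> R" and j: "1 \<le> j"
  shows "integrable M (\<lambda>\<omega>. norm (\<eta> j \<omega>))"
    and "(\<integral>\<omega>. norm (\<eta> j \<omega>) \<partial>M) \<le> 1 + (\<Sum>a\<in>UNIV. R $ a $ a)"
proof -
  interpret prob_space M using noise by (simp add: noise_model_def)
  have nth: "(\<lambda>x::real^'k. x $ a) \<in> borel_measurable borel" for a
    by (intro borel_measurable_continuous_onI continuous_intros)
  note [measurable] = measurable_compose[OF _ nth]
  have [measurable]: "\<eta> j \<in> borel_measurable M" and int: "integrable M (\<lambda>\<omega>. (norm (\<eta> j \<omega>))\<^sup>2)"
    and R: "R $ a $ a = (\<integral>\<omega>. \<eta> j \<omega> $ a * \<eta> j \<omega> $ a \<partial>M)" for a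
    using noise j by (simp_all add: noise_model_def)
  have int1: "integrable M (\<lambda>\<omega>. 1 + (norm (\<eta> j \<omega>))\<^sup>2)" using int by simp
  have le: "norm x \<le> 1 + (norm x)\<^sup>2" for x :: "real^'k"
  proof -
    have "0 \<le> (norm x - 1/2)\<^sup>2" by simp
    then show ?thesis by (simp add: power2_eq_square algebra_simps)
  qed
  show i: "integrable M (\<lambda>\<omega>. norm (\<eta> j \<omega>))"
    by (rule Bochner_Integration.integrable_bound[OF int1]) (use le in \<open>auto simp: abs_of_nonneg\<close>)
  have sq: "integrable M (\<lambda>\<omega>. \<eta> j \<omega> $ a * \<eta> j \<omega> $ a)" for a
  proof (rule Bochner_Integration.integrable_bound[OF int])
    have "\<bar>x $ a * x $ a\<bar> \<le> (norm x)\<^sup>2" for x :: "real^'k"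
      using mult_mono[OF component_le_norm_cart[of x a] component_le_norm_cart[of x a]]
      by (simp add: abs_mult power2_eq_square)
    then show "AE \<omega> in M. norm (\<eta> j \<omega> $ a * \<eta> j \<omega> $ a) \<le> norm ((norm (\<eta> j \<omega>))\<^sup>2)" by simp
  qed measurable
  have "(\<integral>\<omega>. norm (\<eta> j \<omega>) \<partial>M) \<le> (\<integral>\<omega>. 1 + (norm (\<eta> j \<omega>))\<^sup>2 \<partial>M)"
    using i int1 le by (intro integral_mono) auto
  also have "\<dots> = 1 + (\<integral>\<omega>. (norm (\<eta> j \<omega>))\<^sup>2 \<partial>M)"
    using int by (simp add: prob_space)
  also have "(\<integral>\<omega>. (norm (\<eta> j \<omega>))\<^sup>2 \<partial>M) = (\<integral>\<omega>. (\<Sum>a\<in>UNIV. \<eta> j \<omega> $ a * \<eta> j \<omega> $ a) \<partial>M)"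
    by (simp add: power2_norm_eq_inner inner_vec_def)
  also have "\<dots> = (\<Sum>a\<in>UNIV. R $ a $ a)"
    using sq by (simp add: R integral_sum)
  finally show "(\<integral>\<omega>. norm (\<eta> j \<omega>) \<partial>M) \<le> 1 + (\<Sum>a\<in>UNIV. R $ a $ a)" .
qed

context gpf_analysis
begin

lemma gpf_step_analysisI:
  assumes "0 < \<epsilon>" "gaussian_measure m C N"
  shows "gpf_step_analysis H Hs \<beta> \<Psi> r L \<alpha> R a \<rho> e \<epsilon> m C N"
  using assms by (intro gpf_step_analysis.intro gpf_analysis_axioms gpf_step_analysis_axioms.intro)

definition spread_const :: real where "spread_const = sqrt (1 + noise_const / (1 - \<alpha>))"

text \<open>In expectation the pathwise bounds become a scalar affine recursion with slope
  \<open>contraction\<close> and forcing proportional to \<epsilon>; the constant is its fixed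
  point.\<close>

theorem gpf_limsup_le:
  fixes M :: "'w measure" and \<eta> :: "nat \<Rightarrow> 'w \<Rightarrow> real^'k" and C0 :: "'h \<Rightarrow> 'h"
  assumes contr: "contraction < 1" and eps: "0 < \<epsilon>" and init: "\<exists>\<mu>. gaussian_measure m0 C0 \<mu>"
    and M: "prob_space M" and \<eta>: "\<And>j. 1 \<le> j \<Longrightarrow> integrable M (\<lambda>\<omega>. norm (\<eta> j \<omega>))"
      "\<And>j. 1 \<le> j \<Longrightarrow> (\<integral>\<omega>. norm (\<eta> j \<omega>) \<partial>M) \<le> E"
    and absorbed: "\<And>j. J0 \<le> j \<Longrightarrow> (\<Psi> ^^ j) u0 \<in> cball 0 r"
  shows "limsup (\<lambda>j. \<integral>\<^sup>+ \<omega>. ennreal (norm (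
                   fst (gpf \<Psi> r \<beta> H Hs \<epsilon> R (\<lambda>h. a *\<^sub>R P h) m0 C0
                          (\<lambda>i. H ((\<Psi> ^^ i) u0) + \<epsilon> *\<^sub>R \<eta> i \<omega>) j)
                   - (\<Psi> ^^ j) u0)) \<partial>M)
     \<le> ennreal ((contraction * spread_const + residual_const + gain_const * E) / (1 - contraction) * \<epsilon>)"
proof -
  interpret prob_space M by (rule M)
  define X where "X \<omega> j = gpf \<Psi> r \<beta> H Hs \<epsilon> R (\<lambda>h. a *\<^sub>R P h) m0 C0 (\<lambda>i. H ((\<Psi> ^^ i) u0) + \<epsilon> *\<^sub>R \<eta> i \<omega>) j" for \<omega> j
  define u where "u j = (\<Psi> ^^ j) u0" for j
  have X_Suc: "X \<omega> (Suc j) = step \<epsilon> (fst (X \<omega> j), snd (X \<omega> j)) (H (\<Psi> (u j)) + \<epsilon> *\<^sub>R \<eta> (Suc j) \<omega>)" for \<omega> j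
    by (simp add: X_def u_def)
  have "\<exists>N. gaussian_measure (fst (X \<omega> j)) (snd (X \<omega> j)) N" for \<omega> j
  proof (induction j)
    case 0 then show ?case using init by (simp add: X_def)
  next
    case (Suc j)
    then obtain N where "gaussian_measure (fst (X \<omega> j)) (snd (X \<omega> j)) N" by blast
    from gpf_step_analysis.step_gaussian[OF gpf_step_analysisI[OF eps this]]
    show ?case unfolding X_Suc .
  qed
  then obtain N where N: "\<And>\<omega> j. gaussian_measure (fst (X \<omega> j)) (snd (X \<omega> j)) (N \<omega> j)" by metis
  note analysis = gpf_step_analysisI[OF eps N]
  define D where "D = 4 * r\<^sup>2 + \<epsilon>\<^sup>2 * noise_const"
  \<comment> \<open>Fixed point of the trace recursion with slope \<alpha>.\<close>
  define F where "F = \<epsilon>\<^sup>2 * noise_const / (1 - \<alpha>)"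
  have D0: "0 \<le> D" and F0: "0 \<le> F" using noise_const_nonneg alpha by (simp_all add: D_def F_def)
  \<comment> \<open>Indexed from \<open>Suc n\<close>, because the trace is bounded only after the
    first step.\<close>
  have tr: "trV (snd (X \<omega> (Suc n))) \<le> ennreal (\<alpha> ^ n * D + F)" for \<omega> n
  proof (induction n)
    case 0
    have "trV (snd (X \<omega> (Suc 0))) \<le> ennreal D"
      unfolding X_Suc D_def by (rule gpf_step_analysis.trV_step_bounded[OF analysis])
    also have "\<dots> \<le> ennreal (\<alpha> ^ 0 * D + F)" using F0 by (intro ennreal_leI) simp
    finally show ?case .
  next
    case (Suc n)
    have "trV (snd (X \<omega> (Suc (Suc n)))) \<le> ennreal \<alpha> * trV (snd (X \<omega> (Suc n))) + ennreal (\<epsilon>\<^sup>2 * noise_const)"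
      unfolding X_Suc[of \<omega> "Suc n"] by (rule gpf_step_analysis.trV_step_contracts[OF analysis])
    also have "\<dots> \<le> ennreal \<alpha> * ennreal (\<alpha> ^ n * D + F) + ennreal (\<epsilon>\<^sup>2 * noise_const)"
      by (intro add_right_mono mult_left_mono Suc.IH) simp
    also have "\<dots> = ennreal (\<alpha> * (\<alpha> ^ n * D + F) + \<epsilon>\<^sup>2 * noise_const)"
      using alpha D0 F0 noise_const_nonneg
      by (simp add: ennreal_mult'[symmetric] ennreal_plus[symmetric] del: ennreal_plus)
    also have "\<alpha> * (\<alpha> ^ n * D + F) + \<epsilon>\<^sup>2 * noise_const = \<alpha> ^ Suc n * D + F"
    proof -
      have "\<epsilon>\<^sup>2 * noise_const = (1 - \<alpha>) * F" using alpha by (simp add: F_def)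
      then show ?thesis by (simp add: algebra_simps)
    qed
    finally show ?case .
  qed
  define s where "s = \<epsilon> * spread_const"
  have sc: "1 \<le> spread_const" using noise_const_nonneg alpha by (simp add: spread_const_def)
  then have s0: "0 < s" using eps by (simp add: s_def)
  have s2: "s\<^sup>2 = \<epsilon>\<^sup>2 + F"
    using noise_const_nonneg alpha by (simp add: s_def F_def spread_const_def power_mult_distrib algebra_simps)
  have "(\<lambda>n. \<alpha> ^ n * D) \<longlonglongrightarrow> 0 * D" using alpha by (intro tendsto_intros LIMSEQ_realpow_zero) auto
  then have "eventually (\<lambda>n. \<alpha> ^ n * D < \<epsilon>\<^sup>2) sequentially" using eps by (intro order_tendstoD(2)) auto
  then obtain J1 where J1: "\<And>n. J1 \<le> n \<Longrightarrow> \<alpha> ^ n * D < \<epsilon>\<^sup>2" by (auto simp: eventually_sequentially)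
  \<comment> \<open>One beyond both thresholds: the step producing index \<open>J\<close> already
    starts from a signal in the ball, and the covariance at \<open>J\<close> is past its
    transient.\<close>
  define J where "J = Suc (max J0 J1)"
  have small: "trV (snd (X \<omega> j)) \<le> ennreal (s\<^sup>2)" if jJ: "J \<le> j" for \<omega> j
  proof -
    obtain n where n: "j = Suc n" "J1 \<le> n" using jJ by (cases j) (auto simp: J_def)
    have "ennreal (\<alpha> ^ n * D + F) \<le> ennreal (s\<^sup>2)" using J1[OF n(2)] by (intro ennreal_leI) (simp add: s2)
    then show ?thesis using tr[of \<omega> n] n(1) order_trans by blast
  qed
  define err where "err \<omega> j = V (fst (X \<omega> j) - u j)" for \<omega> j
  define B where "B = (sqrt (1 + \<beta>) + gain_const) * (2 * r)"
  have uS: "u (Suc j) = \<Psi> (u j)" for j by (simp add: u_def)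
  have first: "err \<omega> (Suc j) \<le> B + \<epsilon> * (gain_const * norm (\<eta> (Suc j) \<omega>))" if "J0 \<le> j" for \<omega> j
    unfolding err_def X_Suc uS B_def
    by (rule gpf_step_analysis.step_error_bounded[OF analysis absorbed[OF that, folded u_def]])
  have next_err: "err \<omega> (Suc j) \<le> contraction * (err \<omega> j + s) + \<epsilon> * (residual_const + gain_const * norm (\<eta> (Suc j) \<omega>))"
    if "J \<le> j" for \<omega> j
  proof -
    have "J0 \<le> j" using that by (simp add: J_def)
    from gpf_step_analysis.step_error_contracts[OF analysis absorbed[OF this, folded u_def] s0 small[OF that]]
    show ?thesis unfolding err_def X_Suc uS .
  qed
  text \<open>The errors need not be measurable in \<open>\<omega>\<close>, so they are dominated by a measurable recursion.\<close>
  define W where "W = rec_nat (\<lambda>\<omega>. B + \<epsilon> * (gain_const * norm (\<eta> J \<omega>)))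
    (\<lambda>d w \<omega>. contraction * (w \<omega> + s) + \<epsilon> * (residual_const + gain_const * norm (\<eta> (J + Suc d) \<omega>)))"
  have W0: "W 0 = (\<lambda>\<omega>. B + \<epsilon> * (gain_const * norm (\<eta> J \<omega>)))"
    and W_Suc: "W (Suc d) = (\<lambda>\<omega>. contraction * (W d \<omega> + s) + \<epsilon> * (residual_const + gain_const * norm (\<eta> (J + Suc d) \<omega>)))" for d
    by (simp_all add: W_def)
  have err_W: "err \<omega> (J + d) \<le> W d \<omega>" for \<omega> d
  proof (induction d)
    \<comment> \<open>The index \<open>max J0 J1\<close> is the predecessor of
      \<open>J\<close>.\<close>
    case 0 then show ?case using first[of "max J0 J1" \<omega>] by (simp add: W0 J_def)
  next
    case (Suc d)
    have "contraction * (err \<omega> (J + d) + s) \<le> contraction * (W d \<omega> + s)"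
      using Suc contraction_nonneg by (intro mult_left_mono) auto
    then show ?case using next_err[of "J + d" \<omega>] by (simp add: W_Suc)
  qed
  define c where "c = contraction * spread_const + residual_const + gain_const * E"
  have W_int: "integrable M (W d)" for d
    by (induction d) (use \<eta>(1) in \<open>auto simp: W0 W_Suc J_def\<close>)
  have W_le: "(\<integral>\<omega>. W d \<omega> \<partial>M) \<le> contraction ^ d * \<bar>\<integral>\<omega>. W 0 \<omega> \<partial>M\<bar> + \<epsilon> * c / (1 - contraction)" for d
  proof (induction d)
    \<comment> \<open>The start needs a nonnegative fixed point, hence \<open>0 \<le> E\<close>,
      which holds as \<open>E\<close> dominates the mean of a norm.\<close>
    case 0
    have "0 \<le> (\<integral>\<omega>. norm (\<eta> 1 \<omega>) \<partial>M)" by (rule Bochner_Integration.integral_nonneg) simp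
    then have "0 \<le> E" using \<eta>(2)[OF order_refl] by (rule order_trans)
    then have "0 \<le> \<epsilon> * c / (1 - contraction)"
      using eps contr contraction_nonneg residual_const_nonneg gain_const_nonneg sc by (simp add: c_def)
    then show ?case by simp
  next
    case (Suc d)
    have "(\<integral>\<omega>. W (Suc d) \<omega> \<partial>M) = contraction * ((\<integral>\<omega>. W d \<omega> \<partial>M) + s)
       + \<epsilon> * (residual_const + gain_const * (\<integral>\<omega>. norm (\<eta> (J + Suc d) \<omega>) \<partial>M))"
      using W_int[of d] \<eta>(1)[of "J + Suc d"] by (simp add: W_Suc prob_space)
    also have "\<dots> \<le> contraction * ((\<integral>\<omega>. W d \<omega> \<partial>M) + s) + \<epsilon> * (residual_const + gain_const * E)"
      using eps gain_const_nonneg \<eta>(2)[of "J + Suc d"] by (intro add_left_mono mult_left_mono) auto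
    also have "\<dots> = contraction * (\<integral>\<omega>. W d \<omega> \<partial>M) + \<epsilon> * c"
      by (simp add: c_def s_def algebra_simps)
    also have "\<dots> \<le> contraction * (contraction ^ d * \<bar>\<integral>\<omega>. W 0 \<omega> \<partial>M\<bar> + \<epsilon> * c / (1 - contraction)) + \<epsilon> * c"
      using Suc contraction_nonneg by (intro add_right_mono mult_left_mono) auto
    also have "\<dots> = contraction ^ Suc d * \<bar>\<integral>\<omega>. W 0 \<omega> \<partial>M\<bar> + \<epsilon> * c / (1 - contraction)"
    proof -
      define z where "z = \<epsilon> * c / (1 - contraction)"
      have "\<epsilon> * c = (1 - contraction) * z" using contr by (simp add: z_def)
      then show ?thesis unfolding z_def[symmetric] by (simp add: algebra_simps)
    qed
    finally show ?case .
  qed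
  let ?g = "\<lambda>j. ennreal (contraction ^ (j - J) * \<bar>\<integral>\<omega>. W 0 \<omega> \<partial>M\<bar> + \<epsilon> * c / (1 - contraction))"
  have bound: "(\<integral>\<^sup>+ \<omega>. ennreal (norm (fst (X \<omega> j) - u j)) \<partial>M) \<le> ?g j" if "J \<le> j" for j
  proof -
    have "(\<integral>\<^sup>+ \<omega>. ennreal (norm (fst (X \<omega> j) - u j)) \<partial>M) \<le> (\<integral>\<^sup>+ \<omega>. ennreal (W (j - J) \<omega>) \<partial>M)"
    proof (intro nn_integral_mono ennreal_leI)
      fix \<omega> show "norm (fst (X \<omega> j) - u j) \<le> W (j - J) \<omega>"
        using norm_le_V[of "fst (X \<omega> j) - u j"] err_W[of \<omega> "j - J"] that by (simp add: err_def)
    qed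
    also have "\<dots> = ennreal (\<integral>\<omega>. W (j - J) \<omega> \<partial>M)"
    proof (rule nn_integral_eq_integral[OF W_int])
      have "0 \<le> W (j - J) \<omega>" for \<omega> using err_W[of \<omega> "j - J"] V_nonneg order_trans unfolding err_def by blast
      then show "AE \<omega> in M. 0 \<le> W (j - J) \<omega>" by simp
    qed
    also have "\<dots> \<le> ?g j" using W_le by (rule ennreal_leI)
    finally show ?thesis .
  qed
  have "(\<lambda>j. contraction ^ (j - J) * \<bar>\<integral>\<omega>. W 0 \<omega> \<partial>M\<bar> + \<epsilon> * c / (1 - contraction))
     \<longlonglongrightarrow> 0 * \<bar>\<integral>\<omega>. W 0 \<omega> \<partial>M\<bar> + \<epsilon> * c / (1 - contraction)"
  proof (intro tendsto_intros)
    have "(\<lambda>j. contraction ^ j) \<longlonglongrightarrow> 0" using contr contraction_nonneg by (intro LIMSEQ_realpow_zero)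
    then show "(\<lambda>j. contraction ^ (j - J)) \<longlonglongrightarrow> 0" by (intro filterlim_compose[OF _ filterlim_minus_const_nat_at_top])
  qed
  then have lim: "?g \<longlonglongrightarrow> ennreal (\<epsilon> * c / (1 - contraction))" by (intro tendsto_ennrealI) simp
  have "limsup (\<lambda>j. \<integral>\<^sup>+ \<omega>. ennreal (norm (fst (X \<omega> j) - u j)) \<partial>M) \<le> limsup ?g"
    using bound by (intro Limsup_mono) (auto simp: eventually_sequentially)
  also have "\<dots> = ennreal (\<epsilon> * c / (1 - contraction))"
    using lim by (intro lim_imp_Limsup) simp_all
  finally show ?thesis by (simp add: X_def u_def c_def mult.commute)
qed

end

theorem theorem3p2:
  fixes \<Psi> :: "'h::{real_inner,polish_space} \<Rightarrow> 'h"
    and H :: "'h \<Rightarrow> real^'k" and Hs :: "real^'k \<Rightarrow> 'h"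
    and R :: "real^'k^'k" and r \<beta> L \<alpha> :: real
  assumes "bounded_linear H"
    and "\<forall>u y. H u \<bullet> y = u \<bullet> Hs y"
    and "\<forall>y. H (Hs y) = y"
    and "assumptionA r \<beta> L \<alpha> \<Psi> H Hs"
  shows "\<exists>a0. \<forall>a>a0. \<forall>(u0::'h) (m0::'h) (C0::'h op) (M::'w measure) \<eta>.
           (\<exists>\<mu>. gaussian_measure m0 C0 \<mu>) \<and> noise_model M \<eta> R \<longrightarrow>
           (\<exists>C1. \<forall>\<epsilon>>0.
              limsup (\<lambda>j. \<integral>\<^sup>+ \<omega>. ennreal (norm (
                   fst (gpf \<Psi> r \<beta> H Hs \<epsilon> R (\<lambda>h. a *\<^sub>R Pop H Hs h) m0 C0
                          (\<lambda>i. H ((\<Psi> ^^ i) u0) + \<epsilon> *\<^sub>R \<eta> i \<omega>) j)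
                   - (\<Psi> ^^ j) u0)) \<partial>M)
              \<le> ennreal (C1 * \<epsilon>))"
proof (rule exI[of _ "4 * r\<^sup>2 * sqrt L / (1 - sqrt \<alpha>)"], intro allI impI)
  note A = assms(4)[unfolded assumptionA_def]
  fix a u0 m0 and C0 :: "'h op" and M :: "'w measure" and \<eta>
  \<comment> \<open>The threshold is the value of \<open>a\<close> at which
    \<open>contraction\<close> equals 1. It is nonnegative and depends on \<open>r\<close>,
    \<open>L\<close> and \<alpha> only.\<close>
  assume a_large: "4 * r\<^sup>2 * sqrt L / (1 - sqrt \<alpha>) < a"
    and init: "(\<exists>\<mu>. gaussian_measure m0 C0 \<mu>) \<and> noise_model M \<eta> R"
  have noise: "noise_model M \<eta> R" using init ..
  have al: "sqrt \<alpha> < 1" using A by simp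
  have a_pos: "0 < a" using a_large al A by (smt (verit) divide_nonneg_pos mult_nonneg_nonneg real_sqrt_ge_zero zero_le_power2)
  obtain e :: "nat \<Rightarrow> 'h" where e: "\<And>h. (\<lambda>n. (h \<bullet> e n)\<^sup>2) sums (norm h)\<^sup>2"
    using parseval_sequence by blast
  have obs: "observation H Hs" using assms(1-3) by (intro observation.intro) auto
  have lifted: "lifted_observation H Hs \<beta>"
    using A by (intro lifted_observation.intro lifted_observation_axioms.intro obs) auto
  have setting: "filter_setting H Hs \<beta> \<Psi> r L \<alpha>"
    using A by (intro filter_setting.intro filter_setting_axioms.intro lifted) auto
  interpret gpf_analysis H Hs \<beta> \<Psi> r L \<alpha> R a "onorm ((*v) R)" e
    using noise_model_covariance[OF noise] a_pos e onorm[OF matrix_vector_mul_bounded_linear[of R]]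
      onorm_pos_le[OF matrix_vector_mul_bounded_linear[of R]]
    by (intro gpf_analysis.intro gpf_analysis_axioms.intro setting) auto
  have "contraction < 1"
  proof -
    have "4 * r\<^sup>2 * sqrt L < a * (1 - sqrt \<alpha>)" by (rule pos_divide_less_eq[THEN iffD1, OF _ a_large]) (use al in simp)
    then have "4 * r\<^sup>2 / a * sqrt L < 1 - sqrt \<alpha>" using a_pos by (simp add: field_simps)
    then show ?thesis by (simp add: contraction_def)
  qed
  moreover obtain J0 where J0: "(\<Psi> ^^ J0) u0 \<in> cball 0 r" using A by blast
  \<comment> \<open>Absorption provides one entry time; forward invariance keeps the orbit inside
    from then on.\<close>
  have "(\<Psi> ^^ j) u0 \<in> cball 0 r" if "J0 \<le> j" for j
    using that
  proof (induction j rule: dec_induct)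
    case (step n)
    then show ?case using subsetD[OF maps imageI[OF step.IH]] by simp
  qed (rule J0)
  \<comment> \<open>The constant is built from \<open>a\<close>, R and the model parameters, so it
    serves every \<epsilon> at once.\<close>
  ultimately have "limsup (\<lambda>j. \<integral>\<^sup>+ \<omega>. ennreal (norm (
                   fst (gpf \<Psi> r \<beta> H Hs \<epsilon> R (\<lambda>h. a *\<^sub>R Pop H Hs h) m0 C0
                          (\<lambda>i. H ((\<Psi> ^^ i) u0) + \<epsilon> *\<^sub>R \<eta> i \<omega>) j)
                   - (\<Psi> ^^ j) u0)) \<partial>M)
     \<le> ennreal ((contraction * spread_const + residual_const + gain_const * (1 + (\<Sum>k\<in>UNIV. R $ k $ k)))
         / (1 - contraction) * \<epsilon>)" if "0 < \<epsilon>" for \<epsilon>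
    using that init noise noise_model_first_moment[OF noise]
    by (intro gpf_limsup_le) (auto simp: noise_model_def)
  then show "\<exists>C1. \<forall>\<epsilon>>0. limsup (\<lambda>j. \<integral>\<^sup>+ \<omega>. ennreal (norm (
                   fst (gpf \<Psi> r \<beta> H Hs \<epsilon> R (\<lambda>h. a *\<^sub>R Pop H Hs h) m0 C0
                          (\<lambda>i. H ((\<Psi> ^^ i) u0) + \<epsilon> *\<^sub>R \<eta> i \<omega>) j)
                   - (\<Psi> ^^ j) u0)) \<partial>M) \<le> ennreal (C1 * \<epsilon>)"
    by blast
qed

end
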